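(* Let $\mu$ be a probability measure on $\mathbb{R}$ with a positive density $f$ on $\mathbb{R}$ and cumulative distribution function $F$. If $\mu$ satisfies an $L_1$-$L_\infty$ covariance inequality (with some constant $r>0$), then $Is(\mu)>0$ and $$\frac{1}{Is(\mu)}\le \operatorname{Cov}_{1,\infty}(\mu).$$ Furthermore, if $Is(\mu)>0$, then $\mu$ satisfies an $L_1$-$L_\infty$ covariance inequality with constant $Is(\mu)^{-1}$. In other words, $Is(\mu)^{-1}$ is the optimal constant in the $L_1$-$L_\infty$ covariance inequality when the latter is available: $$\frac{1}{Is(\mu)}=\operatorname{Cov}_{1,\infty}(\mu).$$
   Context: Let $a=\inf\{x:F(x)>0\}$, $b=\sup\{x:F(x)<1\}$, and let $m$ be the median of $\mu$. All norms, expectations and covariances are with respect to $\mu$: $\mathbb{E}[h]=\int h\,d\mu$, $\operatorname{Cov}(g,h)=\int g(h-\mathbb{E}[h])\,d\mu$, and $h_0:=h-\mathbb{E}[h]$. For $k\in\overline{\mathbb{R}}=[-\infty,+\infty]$ and $x\in(a,b)$ define $$T_kh(x)=\mathbf{1}_{(a,k]}(x)\frac{1}{F(x)}\int_{(a,x]}h\,dF+\mathbf{1}_{(k,b)}(x)\frac{1}{1-F(x)}\int_{(x,b)}h\,dF .$$ The measure $\mu$ satisfies an $L_1$-$L_\infty$ covariance inequality with constant $r>0$ if for all $g\in L_\infty(F)$ and $h\in L_1(F)$, both absolutely continuous (on every compact interval), $$|\operatorname{Cov}(g,h)|\le r\,\|g'\|_1\,\|T_mh_0\|_\infty .$$ $\operatorname{Cov}_{1,\infty}(\mu)$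 denotes the smallest constant $r$ for which this holds. $Is(\mu)$ is the Cheeger isoperimetric constant: the largest $c\ge 0$ such that $\mu^+(A)\ge c\min\{\mu(A),1-\mu(A)\}$ for all measurable $A\subset\mathbb{R}$, where $\mu^+(A)=\liminf_{h\to0^+}(\mu(A^h)-\mu(A))/h$ and $A^h=\{x:\exists a\in A,\ |x-a|<h\}$. On $\mathbb{R}$, $Is(\mu)=\operatorname{ess\,inf}_{a<x<b}\frac{f(x)}{\min\{F(x),1-F(x)\}}$ (with respect to Lebesgue measure). *)

theory Defs
  imports "HOL-Probability.Probability"
begin

definition lower_endpoint :: "real measure \<Rightarrow> ereal" where
  "lower_endpoint M = Inf (ereal ` {x. cdf M x > 0})"

definition upper_endpoint :: "real measure \<Rightarrow> ereal" where
  "upper_endpoint M = Sup (ereal ` {x. cdf M x < 1})"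

text \<open>The median is unique whenever the distribution function is strictly increasing, in particular
  for a law with positive density.\<close>

definition median :: "real measure \<Rightarrow> real" where
  "median M = (THE m. measure M {..m} \<ge> 1/2 \<and> measure M {m..} \<ge> 1/2)"

definition centered :: "real measure \<Rightarrow> (real \<Rightarrow> real) \<Rightarrow> real \<Rightarrow> real" where
  "centered M h x = h x - (\<integral>y. h y \<partial>M)"

definition cov :: "real measure \<Rightarrow> (real \<Rightarrow> real) \<Rightarrow> (real \<Rightarrow> real) \<Rightarrow> real" where
  "cov M g h = (\<integral>x. g x * centered M h x \<partial>M)"

text \<open>The operator \<open>T\<^sub>k\<close>, set to \<open>0\<close> outside the open interval between the two endpoints.\<close>

definition T_op :: "real measure \<Rightarrow> ereal \<Rightarrow> (real \<Rightarrow> real) \<Rightarrow> real \<Rightarrow> real" where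
  "T_op M k h x = (let a = lower_endpoint M; b = upper_endpoint M in
     if a < ereal x \<and> ereal x < b then
       indicator {a<..k} (ereal x) * (1 / cdf M x)
         * set_lebesgue_integral M {y. a < ereal y \<and> y \<le> x} h
     + indicator {k<..<b} (ereal x) * (1 / (1 - cdf M x))
         * set_lebesgue_integral M {y. x < y \<and> ereal y < b} h
     else 0)"

text \<open>Absolute continuity of functions. A finite family of non-overlapping intervals is given by the
  set \<open>D\<close> of its pairs of endpoints; \<^const>\<open>absolutely_continuous\<close> is an unrelated
  notion, about measures.\<close>

definition abs_continuous_on_interval :: "real \<Rightarrow> real \<Rightarrow> (real \<Rightarrow> real) \<Rightarrow> bool" where
  "abs_continuous_on_interval u v g \<longleftrightarrow>
     (\<forall>\<epsilon>>0. \<exists>\<delta>>0. \<forall>D. finite D \<and> D \<subseteq> {(s, t). u \<le> s \<and> s \<le> t \<and> t \<le> v}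
        \<and> pairwise (\<lambda>p q. {fst p<..<snd p} \<inter> {fst q<..<snd q} = {}) D
        \<and> (\<Sum>(s, t)\<in>D. t - s) < \<delta>
        \<longrightarrow> (\<Sum>(s, t)\<in>D. \<bar>g t - g s\<bar>) < \<epsilon>)"

definition locally_abs_continuous :: "(real \<Rightarrow> real) \<Rightarrow> bool" where
  "locally_abs_continuous g \<longleftrightarrow> (\<forall>u v. u \<le> v \<longrightarrow> abs_continuous_on_interval u v g)"

text \<open>Norms take values in \<open>[0,\<infinity>]\<close>, since \<open>\<parallel>g'\<parallel>\<^sub>1\<close> and \<open>\<parallel>T\<^sub>m h\<^sub>0\<parallel>\<^sub>\<infinity>\<close> may be infinite.\<close>

definition L1_norm :: "real measure \<Rightarrow> (real \<Rightarrow> real) \<Rightarrow> ennreal" where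
  "L1_norm M g = (\<integral>\<^sup>+x. ennreal \<bar>g x\<bar> \<partial>M)"

definition Linf_norm :: "real measure \<Rightarrow> (real \<Rightarrow> real) \<Rightarrow> ennreal" where
  "Linf_norm M g = esssup M (\<lambda>x. ennreal \<bar>g x\<bar>)"

text \<open>A locally absolutely continuous function is differentiable Lebesgue-almost everywhere, and
  \<^const>\<open>deriv\<close> takes one fixed unspecified value at all points of non-differentiability, so for a
  measure with a density these points do not affect \<open>\<parallel>g'\<parallel>\<^sub>1\<close>. The constant \<open>r\<close> is a positive real,
  embedded in \<^typ>\<open>ennreal\<close>. The products follow the convention \<open>0 \<cdot> \<infinity> = 0\<close>.\<close>

definition L1_Linf_cov_ineq :: "real measure \<Rightarrow> ennreal \<Rightarrow> bool" where
  "L1_Linf_cov_ineq M r \<longleftrightarrow> 0 < r \<and> r < \<infinity> \<and>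
     (\<forall>g h. g \<in> borel_measurable M \<and> Linf_norm M g < \<infinity> \<and> integrable M h
        \<and> locally_abs_continuous g \<and> locally_abs_continuous h
        \<longrightarrow> ennreal \<bar>cov M g h\<bar>
            \<le> r * L1_norm M (deriv g) * Linf_norm M (T_op M (ereal (median M)) (centered M h)))"

text \<open>The value is \<open>\<infinity>\<close> if no covariance inequality holds.\<close>

definition Cov_1_inf :: "real measure \<Rightarrow> ennreal" where
  "Cov_1_inf M = Inf {r. L1_Linf_cov_ineq M r}"

definition enlargement :: "real set \<Rightarrow> real \<Rightarrow> real set" where
  "enlargement A h = {x. \<exists>a\<in>A. \<bar>x - a\<bar> < h}"

definition boundary_measure :: "real measure \<Rightarrow> real set \<Rightarrow> ennreal" where
  "boundary_measure M A =
     Liminf (at_right 0) (\<lambda>h. ennreal ((measure M (enlargement A h) - measure M A) / h))"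

text \<open>The supremum is attained, since the defining condition is closed in \<open>c\<close>.\<close>

definition Is :: "real measure \<Rightarrow> ennreal" where
  "Is M = Sup {c. \<forall>A\<in>sets M.
     c * ennreal (min (measure M A) (1 - measure M A)) \<le> boundary_measure M A}"

end

(* Write phi = min F (1 - F), h0 = h - E h and H(t) for the integral of h0 over (-infinity, t].

   From isoperimetry to covariance: the half-lines {..x} give Is * phi <= F' = f almost everywhere, and
   |H| = phi * |T_m h0| by the choice of the median m. Integrating by parts, Cov(g, h) = - int g' H dt, so
   |Cov(g, h)| <= int |g'| phi |T_m h0| dt <= (1 / Is) * int |g'| f dt * sup |T_m h0|.

   From covariance to isoperimetry: for a Borel set A, take g = h = max 0 (1 - dist(x, A) / s). As s -> 0 along a
   sequence realising the liminf in mu^+(A), the covariance tends to mu(A) (1 - mu(A)), the norm of g' is at most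
   (mu(A^s) - mu(A)) / s, and that of T_m h0 is bounded by the sup norm of h0, which tends to
   max (mu(A)) (1 - mu(A)). Dividing by this maximum gives min (mu(A)) (1 - mu(A)) <= r * mu^+(A).

   Both directions need that an absolutely continuous function is differentiable almost everywhere and is the
   integral of its derivative. It is a difference of two monotone absolutely continuous functions (via the total
   variation), whose Stieltjes measures have densities by Radon-Nikodym; Vitali's covering theorem then
   identifies these densities with the derivatives. *)

theory Submission
  imports Defs
begin


section \<open>Lebesgue differentiation\<close>

text \<open>The two directions use \<open>Is\<close> asymmetrically. When \<open>Is\<close> is
  given, its defining inequality may be applied to sets of one's choice, and for a half-line the
  boundary measure is almost everywhere the density. When \<open>Is\<close> is to be bounded from
  below, every Borel set has to be treated, with no interval structure to rely on; this is why the
  test functions are built from the distance to the set alone. The norm of g' refers to the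
  pointwise derivative \<open>deriv g\<close>, whereas integration by parts produces some density of
  g. Matching the two is what calls for a differentiation theorem, and the same theorem applied to
  \<open>cdf\<close> yields the boundary measures of half-lines. Both directions keep the exact
  constant: the operator at the median has the single denominator phi, and mu(A) (1 - mu(A)) factors
  into the minimum and the maximum of mu(A) and 1 - mu(A), the maximum being just the limit of the
  sup norm of h0. Norms and constants may be infinite, so estimates run in \<open>ennreal\<close>
  and reals are extracted once finiteness is known.\<close>

text \<open>The exceptional set of the differentiation theorem, for \<open>w = \<plusminus>(p - q)\<close> with rational \<open>q\<close>. Vitali's theorem
  covers it by disjoint intervals on which \<open>w\<close> has mean above \<open>\<eta>\<close>; since \<open>w \<le> 0\<close> on the set itself, all of this
  mass lies in a difference \<open>U - A\<close> with \<open>U\<close> open, which is arbitrarily small by outer regularity.\<close>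

lemma steep_intervals_null:
  fixes w :: "real \<Rightarrow> real"
  assumes w: "integrable lborel w" and eta: "0 < \<eta>"
  shows "{x \<in> {l<..<u}. w x \<le> 0 \<and> (\<forall>d>0. \<exists>a b. a < x \<and> x < b \<and> b - a < d
            \<and> \<eta> * (b - a) < (LBINT t:{a..b}. w t))} \<in> null_sets lborel" (is "?A \<in> _")
proof -
  have [measurable]: "w \<in> borel_measurable borel"
    using w by auto
  \<comment> \<open>\<open>S n\<close> is open because the endpoints are strict, so the exceptional set is Borel.\<close>
  define S where "S n = {x. \<exists>a b. a < x \<and> x < b \<and> b - a < inverse (Suc n)
      \<and> \<eta> * (b - a) < (LBINT t:{a..b}. w t)}" for n :: nat
  have "open (S n)" for n
    unfolding S_def
    by (intro open_Collect_ex open_Collect_conj open_Collect_const open_Collect_less continuous_intros)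
  then have [measurable]: "S n \<in> sets borel" for n
    by auto
  have S_iff: "(\<forall>n. x \<in> S n) \<longleftrightarrow> (\<forall>d>0. \<exists>a b. a < x \<and> x < b \<and> b - a < d
            \<and> \<eta> * (b - a) < (LBINT t:{a..b}. w t))" for x
    unfolding S_def mem_Collect_eq by (meson inverse_positive_iff_positive of_nat_0_less_iff order_less_trans
        reals_Archimedean zero_less_Suc)
  have "?A = {x \<in> {l<..<u}. w x \<le> 0} \<inter> (\<Inter>n. S n)"
    by (rule set_eqI) (simp add: S_iff)
  then have Am: "?A \<in> sets borel"
    by simp
  define A where "A = ?A"
  have A_le: "w x \<le> 0" and A_sub: "x \<in> {l<..<u}"
    and A_steep: "\<And>d. d > 0 \<Longrightarrow> \<exists>a b. a < x \<and> x < b \<and> b - a < d \<and> \<eta> * (b - a) < (LBINT t:{a..b}. w t)"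
    if "x \<in> A" for x
    using that unfolding A_def by blast+
  have [measurable]: "A \<in> sets borel"
    using Am unfolding A_def .
  define N where "N = density lborel (\<lambda>x. ennreal \<bar>w x\<bar>)"
  have setsN [measurable_cong]: "sets N = sets borel"
    by (simp add: N_def)
  have "emeasure N UNIV < \<infinity>"
    using w by (simp add: N_def emeasure_density integrable_iff_bounded)
  then have finN: "finite_measure N"
    by (auto intro!: finite_measureI simp: N_def)
  interpret N: finite_measure N by (rule finN)
  have small: "emeasure lborel A \<le> ennreal (\<epsilon> / \<eta>)" if "\<epsilon> > 0" for \<epsilon>
  proof -
    have "emeasure N A = (INF U\<in>{U. A \<subseteq> U \<and> open U}. emeasure N U)"
      by (rule outer_regular) (use setsN N.emeasure_finite in \<open>auto simp: top_unique\<close>)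
    moreover have "emeasure N A < emeasure N A + ennreal \<epsilon>"
      using that by (simp add: N.emeasure_eq_measure ennreal_less_iff flip: ennreal_plus)
    ultimately obtain U0 where U0: "A \<subseteq> U0" "open U0" "emeasure N U0 < emeasure N A + ennreal \<epsilon>"
      by (metis (mono_tags, lifting) INF_less_iff mem_Collect_eq)
    have [measurable]: "U0 \<in> sets borel"
      using U0(2) by auto
    have "measure N U0 < measure N A + \<epsilon>"
      using U0(3) that by (simp add: N.emeasure_eq_measure ennreal_less_iff flip: ennreal_plus)
    then have NU0: "measure N (U0 - A) < \<epsilon>"
      using U0 setsN by (subst N.finite_measure_Diff) (auto)
    define U where "U = U0 \<inter> {l<..<u}"
    have U: "A \<subseteq> U" "open U"
      using U0 A_sub by (auto simp: U_def)
    define K where "K = {(a, b). a < b \<and> {a..b} \<subseteq> U \<and> \<eta> * (b - a) < (LBINT t:{a..b}. w t)}"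
    \<comment> \<open>Vitali's theorem is available for balls; midpoint and half-length turn the
      closed intervals of \<open>K\<close> into closed balls.\<close>
    define c where "c = (\<lambda>(a, b). (a + b) / 2 :: real)"
    define r where "r = (\<lambda>(a, b). (b - a) / 2 :: real)"
    have ball: "cball (c i) (r i) = {fst i..snd i}" for i
      by (cases i) (auto simp: c_def r_def cball_eq_atLeastAtMost field_simps)
    have fine: "\<exists>i. i \<in> K \<and> x \<in> cball (c i) (r i) \<and> r i < d" if x: "x \<in> A" and d: "d > 0" for x d
    proof -
      obtain e where e: "e > 0" "ball x e \<subseteq> U"
        using U x open_contains_ball by blast
      have "0 < min d e" using d e by simp
      with A_steep[OF x] obtain a b where ab: "a < x" "x < b" "b - a < min d e" "\<eta> * (b - a) < (LBINT t:{a..b}. w t)"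
        by blast
      have "{a..b} \<subseteq> ball x e"
        using ab by (auto simp: dist_real_def)
      with e ab have "(a, b) \<in> K"
        by (auto simp: K_def)
      with ab show ?thesis
        by (intro exI[of _ "(a, b)"]) (simp add: ball, simp add: r_def)
    qed
    have "0 < r i" if "i \<in> K" for i
      using that by (auto simp: K_def r_def)
    then obtain C where C: "countable C" "C \<subseteq> K"
        "pairwise (\<lambda>i j. disjnt (cball (c i) (r i)) (cball (c j) (r j))) C"
        "negligible (A - (\<Union>i\<in>C. cball (c i) (r i)))"
      by (rule Vitali_covering_theorem_cballs[of K r A c, OF _ fine])
    let ?I = "\<lambda>i. {fst i..snd i::real}"
    let ?T = "\<lambda>C. \<Union>i\<in>C. ?I i"
    \<comment> \<open>Each interval has \<open>w\<close>-integral above \<open>\<eta>\<close> times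
      its length, so the length of a disjoint family is at most the \<open>N\<close>-mass of
      \<open>U0 - A\<close> divided by \<open>\<eta>\<close>. The bound is the same for all finite
      subfamilies and hence passes to the countable cover.\<close>
    have fin: "measure lborel (?T C') \<le> \<epsilon> / \<eta>" if C': "C' \<subseteq> C" "finite C'" for C'
    proof -
      have dj: "disjoint_family_on ?I C'"
        using C(3) C' unfolding disjoint_family_on_def pairwise_def ball disjnt_def by blast
      have K': "fst i < snd i" "{fst i..snd i} \<subseteq> U" "\<eta> * (snd i - fst i) < (LBINT t:?I i. w t)"
        if "i \<in> C'" for i
        using subsetD[OF C(2) subsetD[OF C'(1) that]] unfolding K_def by (auto simp: subset_iff)
      have int: "integrable lborel (\<lambda>t. indicat_real B t *\<^sub>R w t)" if "B \<in> sets borel" for B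
        using w that by (intro integrable_mult_indicator) auto
      have "\<eta> * measure lborel (?T C') = (\<Sum>i\<in>C'. \<eta> * (snd i - fst i))"
        using K' C' dj by (subst measure_finite_Union) (auto simp: sum_distrib_left less_imp_le)
      also have "\<dots> \<le> (\<Sum>i\<in>C'. LBINT t:?I i. w t)"
        using K' by (intro sum_mono less_imp_le)
      also have "\<dots> = (LBINT t:?T C'. w t)"
        using C' dj w
        by (intro set_integral_finite_Union[symmetric])
           (auto simp del: real_scaleR_def simp: set_integrable_def intro!: int)
      also have "\<dots> \<le> (\<integral>t. indicator (U0 - A) t * \<bar>w t\<bar> \<partial>lborel)"
        unfolding set_lebesgue_integral_def
      proof (rule integral_mono)
        show "integrable lborel (\<lambda>t. indicat_real (?T C') t *\<^sub>R w t)"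
          using C' by (intro int) auto
        show "integrable lborel (\<lambda>t. indicat_real (U0 - A) t * \<bar>w t\<bar>)"
          using w integrable_mult_indicator[of "U0 - A" lborel "\<lambda>t. \<bar>w t\<bar>"] by simp
        have "?T C' \<subseteq> U0"
          using K' by (force simp: U_def)
        then show "indicat_real (?T C') t *\<^sub>R w t \<le> indicat_real (U0 - A) t * \<bar>w t\<bar>" for t
          using A_le[of t] subsetD[of "?T C'" U0 t] by (auto simp: indicator_def)
      qed
      also have "\<dots> = measure N (U0 - A)"
        using U0(2) w unfolding N_def
        by (subst integral_eq_nn_integral)
           (auto simp: measure_def emeasure_density ennreal_mult' mult.commute ennreal_indicator intro!: arg_cong[where f=enn2real] nn_integral_cong split: split_indicator)
      finally have "\<eta> * measure lborel (?T C') \<le> \<epsilon>"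
        using NU0 by linarith
      then show ?thesis
        using eta by (simp add: field_simps)
    qed
    have I_fm: "?I i \<in> fmeasurable lborel" for i
      by (auto simp: fmeasurable_def emeasure_lborel_Icc_eq)
    have T: "?T C \<in> fmeasurable lborel" "measure lborel (?T C) \<le> \<epsilon> / \<eta>"
      using fmeasurable_UN_bound[OF C(1) I_fm fin] measure_UN_bound[OF C(1) I_fm fin] by blast+
    have "emeasure lborel A \<le> emeasure lborel (A - ?T C) + emeasure lborel (?T C)"
      using T by (intro order_trans[OF emeasure_mono emeasure_subadditive]) (auto simp: fmeasurable_def)
    also have "emeasure lborel (A - ?T C) = 0"
    proof -
      have "A - ?T C \<in> null_sets lebesgue"
        using C(4) by (simp add: ball negligible_iff_null_sets)
      moreover have "A - ?T C \<in> sets lborel"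
        using T by (auto simp: fmeasurable_def)
      ultimately show ?thesis
        by (simp add: null_sets_completion_iff null_setsD1)
    qed
    also have "0 + emeasure lborel (?T C) \<le> ennreal (\<epsilon> / \<eta>)"
      using T by (simp add: emeasure_eq_measure2 ennreal_leI)
    finally show ?thesis .
  qed
  have le: "emeasure lborel A \<le> ennreal e" if "e > 0" for e
    using small[of "e * \<eta>"] eta that by simp
  have "emeasure lborel A \<le> 0"
    by (rule ennreal_le_epsilon) (simp add: le)
  then have "A \<in> null_sets lborel"
    by (auto simp: null_sets_def)
  then show ?thesis
    unfolding A_def .
qed

text \<open>Differentiability at \<open>x\<close> is reduced to countably many null sets. For
  rational \<open>q\<close> and slack \<open>1 / (k + 1)\<close>, the preceding lemma says that
  almost everywhere \<open>s * p x \<le> s * q\<close> prevents the means of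
  \<open>s * (p - q)\<close> over short intervals around \<open>x\<close> from exceeding the slack.
  The sign \<open>s = 1\<close> bounds difference quotients from above, \<open>s = -1\<close> from
  below.\<close>

theorem lebesgue_differentiation:
  fixes p G :: "real \<Rightarrow> real"
  assumes p: "integrable lborel p"
    and G: "\<And>x y. l < x \<Longrightarrow> x \<le> y \<Longrightarrow> y < u \<Longrightarrow> G y - G x = (LBINT t:{x..y}. p t)"
    and cont: "continuous_on {l<..<u} G"
  shows "AE x in lborel. x \<in> {l<..<u} \<longrightarrow> (G has_real_derivative p x) (at x)"
proof -
  have int_ind: "integrable lborel (\<lambda>t. c * indicat_real {l<..<u} t)" for c
    by (cases "l \<le> u") auto
  define B where "B w \<eta> = {x \<in> {l<..<u}. w x \<le> 0 \<and> (\<forall>d>0. \<exists>a b. a < x \<and> x < b \<and> b - a < d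
            \<and> \<eta> * (b - a) < (LBINT t:{a..b}. w t))}" for w :: "real \<Rightarrow> real" and \<eta> :: real
  \<comment> \<open>The indicator cuts the constant level off outside the interval, since a nonzero
    constant is not integrable on the line.\<close>
  define w where "w s q t = s * p t - s * q * indicat_real {l<..<u} t" for s q t :: real
  have w_int: "integrable lborel (w s q)" for s q
    unfolding w_def using p int_ind by (intro Bochner_Integration.integrable_diff) auto
  have "AE x in lborel. x \<notin> B (w s q) (inverse (Suc k))" for s q and k :: nat
    using steep_intervals_null[OF w_int, of "inverse (Suc k)"] unfolding B_def
    by (intro AE_not_in) simp
  then have "AE x in lborel. \<forall>k. x \<notin> B (w s q) (inverse (real (Suc k)))" for s q
    by (subst AE_all_countable) blast
  then have "AE x in lborel. \<forall>q\<in>\<rat>. \<forall>k. x \<notin> B (w s q) (inverse (real (Suc k)))" for s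
    by (subst AE_ball_countable[OF countable_rat]) blast
  then have "AE x in lborel. \<forall>s\<in>{1,-1}. \<forall>q\<in>\<rat>. \<forall>k. x \<notin> B (w s q) (inverse (real (Suc k)))"
    by (subst AE_ball_countable) auto
  then show ?thesis
  proof (eventually_elim, intro impI)
    fix x assume good: "\<forall>s\<in>{1,-1}. \<forall>q\<in>\<rat>. \<forall>k. x \<notin> B (w s q) (inverse (real (Suc k)))"
      and x: "x \<in> {l<..<u}"
    have w_interval: "(LBINT t:{a..b}. w s q t) = s * (G b - G a) - s * q * (b - a)"
      if "l < a" "a \<le> b" "b < u" for a b s q
    proof -
      have "(LBINT t:{a..b}. w s q t) = (LBINT t:{a..b}. s * p t - s * q)"
        using that by (intro set_lebesgue_integral_cong) (auto simp: w_def)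
      also have "\<dots> = (LBINT t:{a..b}. s * p t) - (LBINT t:{a..b}. s * q)"
      proof (intro set_integral_diff)
        show "set_integrable lborel {a..b} (\<lambda>t. s * p t)"
          using p unfolding set_integrable_def by (intro integrable_mult_indicator) auto
        show "set_integrable lborel {a..b} (\<lambda>t. s * q)"
          unfolding set_integrable_def by (intro integrable_scaleR_left integrable_real_indicator) (auto simp: emeasure_lborel_Icc_eq)
      qed
      also have "(LBINT t:{a..b}. s * p t) = s * (G b - G a)"
        using that G[of a b] by simp
      also have "(LBINT t:{a..b}. s * q) = s * q * (b - a)"
      proof -
        have "(LBINT t:{a..b}. s * q) = (LINT t|lborel. indicat_real {a..b} t) * (s * q)"
          by (simp only: set_lebesgue_integral_def real_scaleR_def integral_mult_left_zero)
        then show ?thesis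
          using that by (simp add: mult.commute)
      qed
      finally show ?thesis .
    qed

    have upper: "\<exists>d>0. \<forall>a b. l < a \<longrightarrow> a \<le> x \<longrightarrow> x \<le> b \<longrightarrow> b < u \<longrightarrow> a < b \<longrightarrow> b - a < d \<longrightarrow>
        s * (G b - G a) \<le> (s * p x + \<epsilon>) * (b - a)"
      if s: "s \<in> {1,-1}" and \<epsilon>: "\<epsilon> > 0" for s \<epsilon> :: real
    proof -
      obtain k where k: "inverse (real (Suc k)) < \<epsilon> / 2"
        using reals_Archimedean[of "\<epsilon> / 2"] \<epsilon> by auto
      obtain q0 where q0: "q0 \<in> \<rat>" "s * p x < q0" "q0 < s * p x + \<epsilon> / 2"
        using Rats_dense_in_real[of "s * p x" "s * p x + \<epsilon> / 2"] \<epsilon> by auto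
      \<comment> \<open>The level handed to \<open>w\<close> is \<open>s * q0\<close>, so that
        \<open>w s (s * q0)\<close> equals \<open>s * p - q0\<close> on the interval. Half of
        \<open>\<epsilon>\<close> pays for \<open>q0\<close> lying above \<open>s * p x\<close>, the
        other half for the slack.\<close>
      have sq: "s * (s * q0) = q0"
        using s by auto
      have "s * q0 \<in> \<rat>"
        using s q0 by auto
      then have "x \<notin> B (w s (s * q0)) (inverse (real (Suc k)))"
        using good s by blast
      moreover have "w s (s * q0) x \<le> 0"
        using q0 x by (simp add: w_def mult.assoc sq)
      ultimately have "\<not> (\<forall>d>0. \<exists>a b. a < x \<and> x < b \<and> b - a < d
            \<and> inverse (real (Suc k)) * (b - a) < (LBINT t:{a..b}. w s (s * q0) t))"
        using x unfolding B_def by blast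
      then obtain d where d: "d > 0" "\<And>a b. a < x \<Longrightarrow> x < b \<Longrightarrow> b - a < d \<Longrightarrow>
          (LBINT t:{a..b}. w s (s * q0) t) \<le> inverse (real (Suc k)) * (b - a)"
        by (metis not_le)
      have open_case: "s * (G b - G a) \<le> (s * p x + \<epsilon>) * (b - a)"
        if "l < a" "a < x" "x < b" "b < u" "b - a < d" for a b
      proof -
        have "s * (G b - G a) - q0 * (b - a) \<le> inverse (real (Suc k)) * (b - a)"
          using d(2)[of a b] that by (simp add: w_interval mult.assoc sq)
        also have "\<dots> \<le> (\<epsilon> / 2) * (b - a)"
          using k that by (intro mult_right_mono) auto
        finally have "s * (G b - G a) \<le> (q0 + \<epsilon> / 2) * (b - a)"
          unfolding distrib_right by linarith
        also have "\<dots> \<le> (s * p x + \<epsilon>) * (b - a)"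
          using q0 that by (intro mult_right_mono) auto
        finally show ?thesis .
      qed
      \<comment> \<open>Difference quotients need \<open>x\<close> as an endpoint, but the
        exceptional sets only speak of \<open>x\<close> in the interior. Both ends are widened by
        \<open>h\<close>, and continuity of \<open>G\<close> permits \<open>h\<close> to tend to
        0.\<close>
      have "s * (G b - G a) \<le> (s * p x + \<epsilon>) * (b - a)"
        if ab: "l < a" "a \<le> x" "x \<le> b" "b < u" "a < b" "b - a < d" for a b
      proof -
        have G_at: "isCont G y" if "l < y" "y < u" for y
          using cont that by (simp add: continuous_on_eq_continuous_at)
        have lhs: "((\<lambda>h. s * (G (b + h) - G (a - h))) \<longlongrightarrow> s * (G (b + 0) - G (a - 0))) (at_right 0)"
          using ab by (intro tendsto_intros isCont_tendsto_compose[OF G_at]) auto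
        have rhs: "((\<lambda>h. (s * p x + \<epsilon>) * ((b + h) - (a - h))) \<longlongrightarrow> (s * p x + \<epsilon>) * ((b + 0) - (a - 0))) (at_right 0)"
          by (intro tendsto_intros)
        have "\<forall>\<^sub>F h in at_right 0. s * (G (b + h) - G (a - h)) \<le> (s * p x + \<epsilon>) * ((b + h) - (a - h))"
        proof -
          \<comment> \<open>For \<open>h < e\<close> the widened interval stays inside
            \<open>(l, u)\<close>, and its length \<open>b - a + 2 * h\<close> stays below
            \<open>d\<close>.\<close>
          define e where "e = Min {a - l, u - b, (d - (b - a)) / 2}"
          have "e > 0" using ab by (auto simp: e_def)
          moreover have "e \<le> a - l" "e \<le> u - b" "e \<le> (d - (b - a)) / 2"
            unfolding e_def by (intro Min.coboundedI; simp)+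
          then have "s * (G (b + h) - G (a - h)) \<le> (s * p x + \<epsilon>) * ((b + h) - (a - h))"
            if "0 < h" "h < e" for h
            using that ab by (intro open_case) auto
          ultimately show ?thesis
            unfolding eventually_at_right_field by (intro exI[of _ e]) simp
        qed
        from tendsto_le[OF _ rhs lhs this] show ?thesis
          by simp
      qed
      with d(1) show ?thesis by blast
    qed
    show "(G has_real_derivative p x) (at x)"
      unfolding has_field_derivative_iff tendsto_iff
    proof (intro allI impI)
      fix e :: real assume "e > 0"
      then have e: "e / 2 > 0" by simp
      have "(1 :: real) \<in> {1, -1}" "(-1 :: real) \<in> {1, -1}"
        by simp_all
      note upper[OF this(1) e] upper[OF this(2) e]
      then obtain d1 d2 where d12: "d1 > 0" "d2 > 0"
        and d1: "\<forall>a b. l < a \<longrightarrow> a \<le> x \<longrightarrow> x \<le> b \<longrightarrow> b < u \<longrightarrow> a < b \<longrightarrow> b - a < d1 \<longrightarrow>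
          1 * (G b - G a) \<le> (1 * p x + e / 2) * (b - a)"
        and d2: "\<forall>a b. l < a \<longrightarrow> a \<le> x \<longrightarrow> x \<le> b \<longrightarrow> b < u \<longrightarrow> a < b \<longrightarrow> b - a < d2 \<longrightarrow>
          - 1 * (G b - G a) \<le> (- 1 * p x + e / 2) * (b - a)"
        by blast
      have bound: "\<bar>(G b - G a) / (b - a) - p x\<bar> < e"
        if "l < a" "a \<le> x" "x \<le> b" "b < u" "a < b" "b - a < d1" "b - a < d2" for a b
      proof -
        have "(G b - G a) / (b - a) \<le> p x + e / 2"
          using d1[rule_format, of a b] that by (simp add: pos_divide_le_eq)
        moreover have "p x - e / 2 \<le> (G b - G a) / (b - a)"
        proof -
          have "(p x - e / 2) * (b - a) = - ((- 1 * p x + e / 2) * (b - a))"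
            by (simp add: algebra_simps)
          also have "\<dots> \<le> - (- 1 * (G b - G a))"
            using d2[rule_format, OF that(1-5) that(7)] by (rule le_imp_neg_le)
          finally have "(p x - e / 2) * (b - a) \<le> G b - G a"
            by simp
          then show ?thesis
            using that by (simp add: pos_le_divide_eq)
        qed
        ultimately show ?thesis
          using \<open>e > 0\<close> by linarith
      qed
      define d where "d = Min {d1, d2, x - l, u - x}"
      have "d > 0" using d12 x by (auto simp: d_def)
      have dd: "d \<le> d1" "d \<le> d2" "d \<le> x - l" "d \<le> u - x"
        by (auto simp: d_def)
      have "dist ((G y - G x) / (y - x)) (p x) < e" if "y \<noteq> x" "dist y x < d" for y
      proof (cases "x < y")
        case True
        then show ?thesis
          using bound[of x y] that dd x by (auto simp: dist_real_def)
      next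
        case False
        have "(G y - G x) / (y - x) = (G x - G y) / (x - y)"
          by (metis minus_diff_eq minus_divide_divide)
        then show ?thesis
          using bound[of y x] that dd x False by (auto simp: dist_real_def)
      qed
      then show "\<forall>\<^sub>F y in at x. dist ((G y - G x) / (y - x)) (p x) < e"
        unfolding eventually_at using \<open>d > 0\<close> by blast
    qed
  qed
qed


section \<open>Absolutely continuous functions\<close>

text \<open>Degenerate pairs are excluded here, in contrast to
  \<open>abs_continuous_on_interval\<close>. Every member then has an interior point, which
  identifies it within the family; this gives injectivity of cuttings and disjointness of
  refinements.\<close>

definition nonoverlapping :: "real \<Rightarrow> real \<Rightarrow> (real \<times> real) set \<Rightarrow> bool" where
  "nonoverlapping u v D \<longleftrightarrow> finite D \<and> D \<subseteq> {(s, t). u \<le> s \<and> s < t \<and> t \<le> v}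
     \<and> pairwise (\<lambda>p q. {fst p<..<snd p} \<inter> {fst q<..<snd q} = {}) D"

definition total_increment :: "(real \<Rightarrow> real) \<Rightarrow> (real \<times> real) set \<Rightarrow> ennreal" where
  "total_increment g D = (\<Sum>p\<in>D. ennreal \<bar>g (snd p) - g (fst p)\<bar>)"

text \<open>With values in \<open>ennreal\<close> the supremum always exists, so additivity can be
  proved before finiteness is known.\<close>

definition variation :: "(real \<Rightarrow> real) \<Rightarrow> real \<Rightarrow> real \<Rightarrow> ennreal" where
  "variation g u v = (SUP D\<in>Collect (nonoverlapping u v). total_increment g D)"

lemma nonoverlapping_empty [simp]: "nonoverlapping u v {}"
  by (simp add: nonoverlapping_def)

lemma nonoverlapping_finite: "nonoverlapping u v D \<Longrightarrow> finite D"
  by (simp add: nonoverlapping_def)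

lemma nonoverlapping_mem:
  "nonoverlapping u v D \<Longrightarrow> p \<in> D \<Longrightarrow> u \<le> fst p \<and> fst p < snd p \<and> snd p \<le> v"
  by (auto simp: nonoverlapping_def)

lemma nonoverlapping_single: "u \<le> s \<Longrightarrow> s < t \<Longrightarrow> t \<le> v \<Longrightarrow> nonoverlapping u v {(s, t)}"
  by (simp add: nonoverlapping_def)

lemma nonoverlapping_eq:
  assumes "nonoverlapping u v D" "p \<in> D" "q \<in> D" "fst p < x" "x < snd p" "fst q < x" "x < snd q"
  shows "p = q"
proof (rule ccontr)
  assume "p \<noteq> q"
  then have "{fst p<..<snd p} \<inter> {fst q<..<snd q} = {}"
    using assms(1-3) unfolding nonoverlapping_def pairwise_def by blast
  then show False
    using assms(4-7) by (auto simp: disjoint_iff)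
qed

text \<open>An interior point of a shrunk interval is interior to the original one, so two members
  whose shrunk versions meet were equal from the start. The lemma serves to cut a family at a
  point.\<close>

lemma nonoverlapping_image:
  assumes D: "nonoverlapping u v D" and sub: "D' \<subseteq> D"
    and \<phi>: "\<And>p. p \<in> D' \<Longrightarrow> fst p \<le> fst (\<phi> p) \<and> fst (\<phi> p) < snd (\<phi> p) \<and> snd (\<phi> p) \<le> snd p
      \<and> u' \<le> fst (\<phi> p) \<and> snd (\<phi> p) \<le> v'"
  shows "nonoverlapping u' v' (\<phi> ` D')" "inj_on \<phi> D'"
proof -
  have eq: "p = q" if "p \<in> D'" "q \<in> D'" "fst (\<phi> p) < x" "x < snd (\<phi> p)" "fst (\<phi> q) < x" "x < snd (\<phi> q)" for p q x
    by (rule nonoverlapping_eq[OF D, of p q x]) (use that sub \<phi>[of p] \<phi>[of q] in auto)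
  show "inj_on \<phi> D'"
  proof (rule inj_onI)
    fix p q assume pq: "p \<in> D'" "q \<in> D'" "\<phi> p = \<phi> q"
    obtain x where "fst (\<phi> p) < x" "x < snd (\<phi> p)"
      using \<phi>[OF pq(1)] dense by blast
    with pq show "p = q"
      by (intro eq[of p q x]) auto
  qed
  have "pairwise (\<lambda>p q. {fst p<..<snd p} \<inter> {fst q<..<snd q} = {}) (\<phi> ` D')"
  proof (rule pairwiseI)
    fix a b assume ab: "a \<in> \<phi> ` D'" "b \<in> \<phi> ` D'" "a \<noteq> b"
    then obtain p q where pq: "p \<in> D'" "q \<in> D'" "a = \<phi> p" "b = \<phi> q" by blast
    show "{fst a<..<snd a} \<inter> {fst b<..<snd b} = {}"
      using eq[OF pq(1,2)] ab(3) pq(3,4) by fastforce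
  qed
  moreover have "\<phi> ` D' \<subseteq> {(s, t). u' \<le> s \<and> s < t \<and> t \<le> v'}"
  proof
    fix a assume "a \<in> \<phi> ` D'"
    then obtain p where "p \<in> D'" "a = \<phi> p" by blast
    then show "a \<in> {(s, t). u' \<le> s \<and> s < t \<and> t \<le> v'}"
      using \<phi>[of p] by (simp add: case_prod_beta)
  qed
  moreover have "finite (\<phi> ` D')"
    using nonoverlapping_finite[OF D] sub by (meson finite_imageI finite_subset)
  ultimately show "nonoverlapping u' v' (\<phi> ` D')"
    by (simp add: nonoverlapping_def)
qed

text \<open>Refinement of each member by a family of its own. An interval cannot come from two
  different members, because its interior would lie in both; hence sums over the union
  split.\<close>

lemma nonoverlapping_UN:
  assumes D: "nonoverlapping u v D" and E: "\<And>p. p \<in> D \<Longrightarrow> nonoverlapping (fst p) (snd p) (E p)"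
  shows "nonoverlapping u v (\<Union>p\<in>D. E p)"
    and "sum h (\<Union>p\<in>D. E p) = (\<Sum>p\<in>D. sum h (E p))"
proof -
  have same: "p = q" if "p \<in> D" "q \<in> D" "a \<in> E p" "b \<in> E q" "fst a < x" "x < snd a" "fst b < x" "x < snd b" for p q a b x
    by (rule nonoverlapping_eq[OF D that(1,2), of x])
      (use that nonoverlapping_mem[OF E[OF that(1)] that(3)] nonoverlapping_mem[OF E[OF that(2)] that(4)] in auto)
  have fin: "finite (E p)" if "p \<in> D" for p
    using E[OF that] by (rule nonoverlapping_finite)
  show "sum h (\<Union>p\<in>D. E p) = (\<Sum>p\<in>D. sum h (E p))"
  proof (rule sum.UNION_disjoint)
    show "\<forall>p\<in>D. \<forall>q\<in>D. p \<noteq> q \<longrightarrow> E p \<inter> E q = {}"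
    proof (intro ballI impI)
      fix p q assume pq: "p \<in> D" "q \<in> D" "p \<noteq> q"
      have False if a: "a \<in> E p" "a \<in> E q" for a
      proof -
        have "fst a < snd a"
          using nonoverlapping_mem[OF E[OF pq(1)] a(1)] by simp
        then obtain x where "fst a < x" "x < snd a" using dense by blast
        then show False
          using same[OF pq(1,2) a] pq(3) by blast
      qed
      then show "E p \<inter> E q = {}" by blast
    qed
  qed (use fin nonoverlapping_finite[OF D] in auto)
  have "pairwise (\<lambda>p q. {fst p<..<snd p} \<inter> {fst q<..<snd q} = {}) (\<Union>p\<in>D. E p)"
  proof (rule pairwiseI)
    fix a b assume ab: "a \<in> (\<Union>p\<in>D. E p)" "b \<in> (\<Union>p\<in>D. E p)" "a \<noteq> b"
    then obtain p q where pq: "p \<in> D" "q \<in> D" "a \<in> E p" "b \<in> E q" by blast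
    have False if x: "fst a < x" "x < snd a" "fst b < x" "x < snd b" for x
    proof -
      have "q = p"
        using same[OF pq x] by simp
      then show False
        using nonoverlapping_eq[OF E[OF pq(1)] pq(3) _ x] pq(4) ab(3) by simp
    qed
    then show "{fst a<..<snd a} \<inter> {fst b<..<snd b} = {}"
      unfolding disjoint_iff greaterThanLessThan_iff by blast
  qed
  moreover have "(\<Union>p\<in>D. E p) \<subseteq> {(s, t). u \<le> s \<and> s < t \<and> t \<le> v}"
  proof
    fix a assume "a \<in> (\<Union>p\<in>D. E p)"
    then obtain p where p: "p \<in> D" "a \<in> E p" by blast
    show "a \<in> {(s, t). u \<le> s \<and> s < t \<and> t \<le> v}"
      using nonoverlapping_mem[OF D p(1)] nonoverlapping_mem[OF E[OF p(1)] p(2)] by (auto simp: case_prod_beta)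
  qed
  ultimately show "nonoverlapping u v (\<Union>p\<in>D. E p)"
    using fin nonoverlapping_finite[OF D] by (simp add: nonoverlapping_def)
qed

text \<open>Suprema over independent choices may be taken one index at a time; the summand
  \<open>a\<close> absorbs the choice already made, which is what the induction needs.\<close>

lemma sum_SUP_le_ennreal:
  fixes f :: "'a \<Rightarrow> 'b \<Rightarrow> ennreal"
  assumes "finite D" and ne: "\<And>p. p \<in> D \<Longrightarrow> F p \<noteq> {}"
    and le: "\<And>E. (\<And>p. p \<in> D \<Longrightarrow> E p \<in> F p) \<Longrightarrow> a + (\<Sum>p\<in>D. f p (E p)) \<le> c"
  shows "a + (\<Sum>p\<in>D. SUP e\<in>F p. f p e) \<le> c"
  using assms
proof (induction D arbitrary: a rule: finite_induct)
  case (insert q D)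
  have "(a + f q e) + (\<Sum>p\<in>D. SUP e\<in>F p. f p e) \<le> c" if e: "e \<in> F q" for e
  proof (rule insert.IH)
    fix E assume E: "\<And>p. p \<in> D \<Longrightarrow> E p \<in> F p"
    have "a + (\<Sum>p\<in>insert q D. f p ((E(q := e)) p)) \<le> c"
      by (rule insert.prems(2)) (use E e in auto)
    moreover have "(\<Sum>p\<in>D. f p ((E(q := e)) p)) = (\<Sum>p\<in>D. f p (E p))"
      using insert.hyps by (intro sum.cong) auto
    ultimately show "a + f q e + (\<Sum>p\<in>D. f p (E p)) \<le> c"
      using insert.hyps by (simp add: add.assoc)
  qed (use insert.prems in auto)
  then have "(SUP e\<in>F q. (a + (\<Sum>p\<in>D. SUP e\<in>F p. f p e)) + f q e) \<le> c"
    by (intro SUP_least) (simp add: ac_simps)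
  also have "(SUP e\<in>F q. (a + (\<Sum>p\<in>D. SUP e\<in>F p. f p e)) + f q e)
      = (a + (\<Sum>p\<in>D. SUP e\<in>F p. f p e)) + (SUP e\<in>F q. f q e)"
    using insert.prems(1)[of q] by (simp add: ennreal_SUP_add_right)
  finally show ?case
    using insert.hyps by (simp add: ac_simps)
qed auto

lemma variation_upper: "nonoverlapping u v D \<Longrightarrow> total_increment g D \<le> variation g u v"
  unfolding variation_def by (rule SUP_upper) simp

lemma nonoverlapping_length:
  assumes D: "nonoverlapping u v D"
  shows "(\<Sum>p\<in>D. snd p - fst p) = measure lborel (\<Union>p\<in>D. {fst p<..<snd p})"
proof -
  have "disjoint_family_on (\<lambda>p. {fst p<..<snd p}) D"
    using D unfolding nonoverlapping_def pairwise_def disjoint_family_on_def by blast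
  then have "measure lborel (\<Union>p\<in>D. {fst p<..<snd p}) = (\<Sum>p\<in>D. measure lborel {fst p<..<snd p})"
    using nonoverlapping_finite[OF D] nonoverlapping_mem[OF D]
    by (intro measure_finite_Union) (auto simp: less_imp_le)
  also have "\<dots> = (\<Sum>p\<in>D. snd p - fst p)"
    using nonoverlapping_mem[OF D] by (intro sum.cong) (auto simp: less_imp_le)
  finally show ?thesis ..
qed

lemma nonoverlapping_length_le:
  assumes D: "nonoverlapping u v D" and "u \<le> v"
  shows "(\<Sum>p\<in>D. snd p - fst p) \<le> v - u"
proof -
  have "measure lborel (\<Union>p\<in>D. {fst p<..<snd p}) \<le> measure lborel {u..v}"
    using nonoverlapping_mem[OF D] nonoverlapping_finite[OF D]
    by (intro measure_mono_fmeasurable) (force simp: fmeasurable_def emeasure_lborel_Icc_eq)+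
  then show ?thesis
    using assms by (simp add: nonoverlapping_length)
qed

text \<open>Families chosen inside the members of \<open>D\<close> unite to one family
  \<open>E\<close> in \<open>[u, v]\<close> that is no longer than \<open>D\<close>. Keeping track
  of the length is what later transfers the \<open>\<delta>\<close> of absolute continuity from
  \<open>g\<close> to its variation.\<close>

lemma sum_variation_le:
  assumes D: "nonoverlapping u v D"
    and le: "\<And>E. nonoverlapping u v E \<Longrightarrow>
      (\<Sum>e\<in>E. snd e - fst e) \<le> (\<Sum>p\<in>D. snd p - fst p) \<Longrightarrow> total_increment g E \<le> c"
  shows "(\<Sum>p\<in>D. variation g (fst p) (snd p)) \<le> c"
proof -
  have "0 + (\<Sum>p\<in>D. SUP E\<in>Collect (nonoverlapping (fst p) (snd p)). total_increment g E) \<le> c"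
  proof (rule sum_SUP_le_ennreal)
    show "finite D" using D by (rule nonoverlapping_finite)
    show "Collect (nonoverlapping (fst p) (snd p)) \<noteq> {}" for p
      using nonoverlapping_empty by blast
    fix E assume "\<And>p. p \<in> D \<Longrightarrow> E p \<in> Collect (nonoverlapping (fst p) (snd p))"
    then have E: "\<And>p. p \<in> D \<Longrightarrow> nonoverlapping (fst p) (snd p) (E p)" by simp
    have "(\<Sum>e\<in>(\<Union>p\<in>D. E p). snd e - fst e) = (\<Sum>p\<in>D. \<Sum>e\<in>E p. snd e - fst e)"
      by (rule nonoverlapping_UN(2)[OF D E])
    also have "\<dots> \<le> (\<Sum>p\<in>D. snd p - fst p)"
      using nonoverlapping_mem[OF D] by (intro sum_mono nonoverlapping_length_le E) (auto simp: less_imp_le)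
    finally have "total_increment g (\<Union>p\<in>D. E p) \<le> c"
      by (intro le nonoverlapping_UN(1)[OF D E])
    moreover have "total_increment g (\<Union>p\<in>D. E p) = (\<Sum>p\<in>D. total_increment g (E p))"
      unfolding total_increment_def by (rule nonoverlapping_UN(2)[OF D E])
    ultimately show "0 + (\<Sum>p\<in>D. total_increment g (E p)) \<le> c"
      by simp
  qed
  then show ?thesis
    by (simp add: variation_def)
qed

lemma variation_refl [simp]: "variation g u u = 0"
proof -
  have "D = {}" if "nonoverlapping u u D" for D
    using nonoverlapping_mem[OF that] by force
  then have "Collect (nonoverlapping u u) = {{}}"
    by auto
  then show ?thesis
    by (simp add: variation_def total_increment_def)
qed

lemma variation_superadditive:
  assumes "u \<le> w" "w \<le> v"
  shows "variation g u w + variation g w v \<le> variation g u v"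
proof (cases "u = w \<or> w = v")
  case False
  with assms have uwv: "u < w" "w < v" by auto
  then have D: "nonoverlapping u v {(u, w), (w, v)}"
    by (auto simp: nonoverlapping_def pairwise_def)
  have "(\<Sum>p\<in>{(u, w), (w, v)}. variation g (fst p) (snd p)) \<le> variation g u v"
    by (rule sum_variation_le[OF D]) (rule variation_upper)
  then show ?thesis
    using uwv by simp
qed auto

text \<open>A member that straddles \<open>w\<close> is cut there; by the triangle inequality the
  two pieces have at least the same total increment.\<close>

lemma variation_subadditive:
  assumes "u \<le> w" "w \<le> v"
  shows "variation g u v \<le> variation g u w + variation g w v"
  unfolding variation_def[of g u v]
proof (rule SUP_least)
  fix D assume "D \<in> Collect (nonoverlapping u v)"
  then have D: "nonoverlapping u v D" by simp
  define D1 where "D1 = {p\<in>D. fst p < w}"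
  define D2 where "D2 = {p\<in>D. w < snd p}"
  define \<phi>1 where "\<phi>1 p = (fst p, min (snd p) w)" for p :: "real \<times> real"
  define \<phi>2 where "\<phi>2 p = (max (fst p) w, snd p)" for p :: "real \<times> real"
  have 1: "nonoverlapping u w (\<phi>1 ` D1)" "inj_on \<phi>1 D1"
    using nonoverlapping_image[OF D, of D1 \<phi>1 u w] nonoverlapping_mem[OF D]
    by (auto simp: D1_def \<phi>1_def)
  have 2: "nonoverlapping w v (\<phi>2 ` D2)" "inj_on \<phi>2 D2"
    using nonoverlapping_image[OF D, of D2 \<phi>2 w v] nonoverlapping_mem[OF D]
    by (auto simp: D2_def \<phi>2_def)
  have fin: "finite D" using D by (rule nonoverlapping_finite)
  let ?a = "\<lambda>p. ennreal \<bar>g (min (snd p) w) - g (fst p)\<bar>"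
  let ?b = "\<lambda>p. ennreal \<bar>g (snd p) - g (max (fst p) w)\<bar>"
  have "total_increment g D \<le> (\<Sum>p\<in>D. (if fst p < w then ?a p else 0) + (if w < snd p then ?b p else 0))"
    unfolding total_increment_def
  proof (rule sum_mono)
    fix p assume "p \<in> D"
    then have "fst p < snd p" using nonoverlapping_mem[OF D] by blast
    then show "ennreal \<bar>g (snd p) - g (fst p)\<bar> \<le> (if fst p < w then ?a p else 0) + (if w < snd p then ?b p else 0)"
      by (auto simp: min_def max_def simp flip: ennreal_plus intro!: ennreal_leI)
  qed
  also have "\<dots> = (\<Sum>p\<in>D1. ?a p) + (\<Sum>p\<in>D2. ?b p)"
    unfolding D1_def D2_def using fin by (simp add: sum.distrib sum.inter_filter del: sum_ennreal)
  also have "(\<Sum>p\<in>D1. ?a p) = total_increment g (\<phi>1 ` D1)"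
    unfolding total_increment_def by (subst sum.reindex[OF 1(2)]) (simp add: \<phi>1_def)
  also have "(\<Sum>p\<in>D2. ?b p) = total_increment g (\<phi>2 ` D2)"
    unfolding total_increment_def by (subst sum.reindex[OF 2(2)]) (simp add: \<phi>2_def)
  also have "total_increment g (\<phi>1 ` D1) + total_increment g (\<phi>2 ` D2) \<le> variation g u w + variation g w v"
    using 1 2 by (intro add_mono variation_upper)
  finally show "total_increment g D \<le> variation g u w + variation g w v" .
qed

lemma variation_additive:
  assumes "u \<le> w" "w \<le> v"
  shows "variation g u v = variation g u w + variation g w v"
  using assms by (intro antisym variation_subadditive variation_superadditive)

lemma increment_le_variation:
  assumes "u \<le> v"
  shows "ennreal \<bar>g v - g u\<bar> \<le> variation g u v"
proof (cases "u = v")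
  case False
  then show ?thesis
    using variation_upper[OF nonoverlapping_single, of u u v v g] assms
    by (simp add: total_increment_def)
qed simp

lemma abs_continuous_total_increment:
  assumes ac: "abs_continuous_on_interval u v g" and "\<epsilon> > 0"
  obtains \<delta> where "\<delta> > 0"
    "\<And>D. nonoverlapping u v D \<Longrightarrow> (\<Sum>p\<in>D. snd p - fst p) < \<delta> \<Longrightarrow> total_increment g D \<le> ennreal \<epsilon>"
proof -
  obtain \<delta> where \<delta>: "\<delta> > 0" "\<And>D. finite D \<Longrightarrow> D \<subseteq> {(s, t). u \<le> s \<and> s \<le> t \<and> t \<le> v} \<Longrightarrow>
      pairwise (\<lambda>p q. {fst p<..<snd p} \<inter> {fst q<..<snd q} = {}) D \<Longrightarrow>
      (\<Sum>(s, t)\<in>D. t - s) < \<delta> \<Longrightarrow> (\<Sum>(s, t)\<in>D. \<bar>g t - g s\<bar>) < \<epsilon>"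
    using ac \<open>\<epsilon> > 0\<close> unfolding abs_continuous_on_interval_def by meson
  have "total_increment g D \<le> ennreal \<epsilon>" if "nonoverlapping u v D" "(\<Sum>p\<in>D. snd p - fst p) < \<delta>" for D
  proof -
    have "D \<subseteq> {(s, t). u \<le> s \<and> s \<le> t \<and> t \<le> v}"
      using nonoverlapping_mem[OF that(1)] by fastforce
    then have "(\<Sum>(s, t)\<in>D. \<bar>g t - g s\<bar>) < \<epsilon>"
      using \<delta>(2)[of D] that by (simp add: nonoverlapping_def case_prod_beta)
    then show ?thesis
      unfolding total_increment_def by (simp add: case_prod_beta ennreal_leI)
  qed
  with \<delta>(1) show thesis by (rule that)
qed

text \<open>The \<open>\<delta>\<close> that works for \<open>g\<close> also works for its
  variation, because refining a family does not increase its length. So the variation function is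
  itself absolutely continuous.\<close>

lemma abs_continuous_sum_variation:
  assumes ac: "abs_continuous_on_interval u v g" and "\<epsilon> > 0"
  obtains \<delta> where "\<delta> > 0"
    "\<And>D. nonoverlapping u v D \<Longrightarrow> (\<Sum>p\<in>D. snd p - fst p) < \<delta> \<Longrightarrow>
      (\<Sum>p\<in>D. variation g (fst p) (snd p)) \<le> ennreal \<epsilon>"
proof -
  obtain \<delta> where \<delta>: "\<delta> > 0"
    "\<And>D. nonoverlapping u v D \<Longrightarrow> (\<Sum>p\<in>D. snd p - fst p) < \<delta> \<Longrightarrow> total_increment g D \<le> ennreal \<epsilon>"
    using abs_continuous_total_increment[OF assms] by blast
  have "(\<Sum>p\<in>D. variation g (fst p) (snd p)) \<le> ennreal \<epsilon>"
    if "nonoverlapping u v D" "(\<Sum>p\<in>D. snd p - fst p) < \<delta>" for D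
    using that by (intro sum_variation_le[OF that(1)] \<delta>(2)) auto
  with \<delta>(1) show thesis by (rule that)
qed

text \<open>With \<open>\<epsilon> = 1\<close>, every interval shorter than \<open>\<delta>\<close>
  has variation at most 1. The induction advances in steps of \<open>\<delta> / 2\<close>, strictly
  below \<open>\<delta>\<close>, and uses additivity.\<close>

lemma variation_finite:
  assumes ac: "abs_continuous_on_interval u v g" and "u \<le> x" "x \<le> y" "y \<le> v"
  shows "variation g x y < \<infinity>"
proof -
  obtain \<delta> where \<delta>: "\<delta> > 0"
    "\<And>D. nonoverlapping u v D \<Longrightarrow> (\<Sum>p\<in>D. snd p - fst p) < \<delta> \<Longrightarrow>
      (\<Sum>p\<in>D. variation g (fst p) (snd p)) \<le> ennreal 1"
    using abs_continuous_sum_variation[OF ac, of 1] by auto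
  have short: "variation g s t \<le> 1" if "u \<le> s" "s \<le> t" "t \<le> v" "t - s < \<delta>" for s t
    using \<delta>(2)[OF nonoverlapping_single, of s t] that by (cases "s = t") auto
  have "variation g x y < \<infinity>" if "x \<le> y" "y \<le> v" "y - x \<le> real k * (\<delta> / 2)" for k y
    using that
  proof (induction k arbitrary: y)
    case 0
    then show ?case by simp
  next
    case (Suc k)
    define w where "w = max x (y - \<delta> / 2)"
    have w: "x \<le> w" "w \<le> y" "y - w < \<delta>"
      using Suc.prems \<delta>(1) by (auto simp: w_def)
    have "0 \<le> real k * (\<delta> / 2)"
      using \<delta>(1) by simp
    moreover have "y - x \<le> real k * (\<delta> / 2) + \<delta> / 2"
      using Suc.prems by (simp add: algebra_simps)
    moreover have "w = x \<or> w = y - \<delta> / 2"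
      by (auto simp: w_def max_def)
    ultimately have "w - x \<le> real k * (\<delta> / 2)"
      by (elim disjE) linarith+
    then have "variation g x w < \<infinity>"
      using Suc w by auto
    moreover have "variation g w y < \<infinity>"
      using short[of w y] w Suc.prems assms by (simp add: le_less_trans)
    ultimately show ?case
      using variation_additive[OF w(1,2), of g] by simp
  qed
  moreover obtain k :: nat where "(y - x) / (\<delta> / 2) \<le> real k"
    using real_arch_simple by blast
  ultimately show ?thesis
    using assms \<delta>(1) by (simp add: field_simps)
qed


section \<open>Densities of monotone and of absolutely continuous functions\<close>

text \<open>The Stieltjes measure of \<open>G\<close> vanishes on Lebesgue null sets: such a set is
  covered by intervals of total length below \<open>\<delta>\<close>, and the measure of the cover
  is the sum of the increments of \<open>G\<close>, hence at most \<open>\<epsilon>\<close>.\<close>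

lemma mono_abs_continuous_density:
  fixes G :: "real \<Rightarrow> real"
  assumes "u < v"
    and mono: "\<And>x y. u \<le> x \<Longrightarrow> x \<le> y \<Longrightarrow> y \<le> v \<Longrightarrow> G x \<le> G y"
    and ac: "\<And>\<epsilon>. \<epsilon> > 0 \<Longrightarrow> \<exists>\<delta>>0. \<forall>D. nonoverlapping u v D \<longrightarrow> (\<Sum>p\<in>D. snd p - fst p) < \<delta> \<longrightarrow>
      (\<Sum>p\<in>D. G (snd p) - G (fst p)) \<le> \<epsilon>"
  obtains p where "integrable lborel p"
    "\<And>x y. u \<le> x \<Longrightarrow> x \<le> y \<Longrightarrow> y \<le> v \<Longrightarrow> G y - G x = (LBINT t:{x..y}. p t)"
proof -
  \<comment> \<open>Constant continuation beyond \<open>[u, v]\<close> yields a monotone continuous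
    function on the whole line, as \<open>interval_measure\<close> requires.\<close>
  define H where "H x = G (max u (min v x))" for x
  have H_eq: "H x = G x" if "u \<le> x" "x \<le> v" for x
    using that by (simp add: H_def)
  have H_mono: "H x \<le> H y" if "x \<le> y" for x y
    unfolding H_def using that \<open>u < v\<close> by (intro mono) auto
  have "continuous_on {u..v} G"
    unfolding continuous_on_iff
  proof (intro ballI allI impI)
    fix x e :: real assume x: "x \<in> {u..v}" and "e > 0"
    then obtain \<delta> where \<delta>: "\<delta> > 0" "\<And>D. nonoverlapping u v D \<Longrightarrow> (\<Sum>p\<in>D. snd p - fst p) < \<delta> \<Longrightarrow>
        (\<Sum>p\<in>D. G (snd p) - G (fst p)) \<le> e / 2"
      using ac[of "e / 2"] by auto
    have half: "G t - G s \<le> e / 2" if "u \<le> s" "s < t" "t \<le> v" "t - s < \<delta>" for s t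
      using \<delta>(2)[OF nonoverlapping_single, of s t] that by simp
    have "dist (G y) (G x) < e" if y: "y \<in> {u..v}" "dist y x < \<delta>" for y
    proof (cases y x rule: linorder_cases)
      case less
      then show ?thesis
        using half[of y x] mono[of y x] x y \<open>e > 0\<close> by (simp add: dist_real_def)
    next
      case greater
      then show ?thesis
        using half[of x y] mono[of x y] x y \<open>e > 0\<close> by (simp add: dist_real_def)
    qed (use \<open>e > 0\<close> in simp)
    then show "\<exists>d>0. \<forall>x'\<in>{u..v}. dist x' x < d \<longrightarrow> dist (G x') (G x) < e"
      using \<delta>(1) by blast
  qed
  then have "continuous_on UNIV (\<lambda>x. G (max u (min v x)))"
    by (rule continuous_on_compose2) (use \<open>u < v\<close> in \<open>auto intro!: continuous_intros\<close>)
  then have H_cont: "continuous_on UNIV H"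
    by (simp add: H_def[abs_def])
  define M where "M = interval_measure H"
  have M_Icc: "emeasure M {x..y} = ennreal (H y - H x)" if "x \<le> y" for x y
    unfolding M_def using that H_mono H_cont by (rule emeasure_interval_measure_Icc)
  have [simp]: "sets M = sets borel" "space M = UNIV"
    by (simp_all add: M_def)
  \<comment> \<open>Restriction to \<open>[u, v]\<close> lets a null set be cut down to the compact
    interval on which the covering and \<open>ac\<close> live, and makes the total mass
    \<open>H v - H u\<close>.\<close>
  define N where "N = density M (indicator {u..v})"
  have N_eq: "emeasure N A = emeasure M (A \<inter> {u..v})" if "A \<in> sets borel" for A
    using that unfolding N_def by (subst emeasure_density) (auto simp: M_def Int_commute simp flip: indicator_inter_arith)
  have setsN [simp]: "sets N = sets borel"
    by (simp add: N_def)
  have ac_N: "absolutely_continuous lborel N"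
    unfolding absolutely_continuous_def
  proof
    fix A :: "real set" assume A: "A \<in> null_sets lborel"
    define S where "S = A \<inter> {u..v}"
    have S: "S \<in> null_sets lborel"
      unfolding S_def using A by (intro null_set_Int2) auto
    then have [measurable]: "S \<in> sets borel" by auto
    have "S \<in> null_sets lebesgue"
      using S null_sets_completionI by blast
    then have S': "S \<in> lmeasurable" "measure lebesgue S = 0"
      by (auto simp: fmeasurableI_null_sets measure_eq_0_null_sets)
    have le: "emeasure M S \<le> 0 + ennreal \<epsilon>" if \<epsilon>: "\<epsilon> > 0" for \<epsilon>
    proof -
      obtain \<delta> where \<delta>: "\<delta> > 0" "\<And>D. nonoverlapping u v D \<Longrightarrow> (\<Sum>p\<in>D. snd p - fst p) < \<delta> \<Longrightarrow>
          (\<Sum>p\<in>D. G (snd p) - G (fst p)) \<le> \<epsilon>"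
        using ac[OF \<epsilon>] by blast
      \<comment> \<open>As \<open>S\<close> has measure 0, the allowance \<open>\<delta> / 2\<close>
        keeps the length of the cover strictly below \<open>\<delta>\<close>.\<close>
      have "S \<subseteq> cbox u v" by (simp add: S_def)
      then obtain \<D> where \<D>: "countable \<D>"
        "\<And>K. K \<in> \<D> \<Longrightarrow> K \<subseteq> cbox u v \<and> K \<noteq> {} \<and> (\<exists>c d. K = cbox c d)"
        "pairwise (\<lambda>A B. interior A \<inter> interior B = {}) \<D>"
        "\<And>K. K \<in> \<D> \<Longrightarrow> box u v \<noteq> {} \<Longrightarrow> interior K \<noteq> {}"
        "S \<subseteq> \<Union>\<D>" "\<Union>\<D> \<in> lmeasurable" "measure lebesgue (\<Union>\<D>) \<le> measure lebesgue S + \<delta> / 2"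
        using measurable_outer_intervals_bounded[OF S'(1), of u v "\<delta> / 2"] \<delta>(1) by (metis half_gt_zero)
      \<comment> \<open>Since \<open>u < v\<close>, the covering boxes have nonempty interior, so
        each is a nondegenerate interval that its infimum and supremum recover.\<close>
      have K: "Inf K < Sup K" "K = {Inf K..Sup K}" "u \<le> Inf K" "Sup K \<le> v" if KD: "K \<in> \<D>" for K
      proof -
        obtain c d where "K = cbox c d" "K \<noteq> {}" "K \<subseteq> cbox u v"
          using \<D>(2)[OF KD] by blast
        then have cd: "K = {c..d}" "c \<le> d" "u \<le> c" "d \<le> v"
          by auto
        moreover have "c < d"
          using \<D>(4)[OF KD] cd \<open>u < v\<close> by auto
        ultimately show "Inf K < Sup K" "K = {Inf K..Sup K}" "u \<le> Inf K" "Sup K \<le> v"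
          by auto
      qed
      \<comment> \<open>Absolute continuity concerns finite families only; the bound, being uniform
        in them, extends to the countable cover.\<close>
      have fin: "measure M (\<Union>\<E>) \<le> \<epsilon>" if \<E>: "\<E> \<subseteq> \<D>" "finite \<E>" for \<E>
      proof -
        define ends where "ends K = (Inf K, Sup K)" for K :: "real set"
        have inj: "inj_on ends \<E>"
          using K \<E> by (intro inj_onI) (metis ends_def prod.inject subsetD)
        have D: "nonoverlapping u v (ends ` \<E>)"
          unfolding nonoverlapping_def
        proof (intro conjI)
          show "ends ` \<E> \<subseteq> {(s, t). u \<le> s \<and> s < t \<and> t \<le> v}"
            using K \<E> by (auto simp: ends_def)
          show "pairwise (\<lambda>p q. {fst p<..<snd p} \<inter> {fst q<..<snd q} = {}) (ends ` \<E>)"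
          proof (rule pairwiseI)
            fix a b assume ab: "a \<in> ends ` \<E>" "b \<in> ends ` \<E>" "a \<noteq> b"
            then obtain A B where AB: "A \<in> \<E>" "B \<in> \<E>" "a = ends A" "b = ends B" "A \<noteq> B" by blast
            then have "interior A \<inter> interior B = {}"
              using \<D>(3) \<E>(1) unfolding pairwise_def by blast
            moreover have "interior A = {fst a<..<snd a}" "interior B = {fst b<..<snd b}"
              using K(2)[of A] K(2)[of B] AB \<E>(1) by (metis ends_def fst_conv interior_atLeastAtMost_real snd_conv subsetD)+
            ultimately show "{fst a<..<snd a} \<inter> {fst b<..<snd b} = {}" by simp
          qed
        qed (use \<E> in simp)
        have "(\<Sum>p\<in>ends ` \<E>. snd p - fst p) = measure lborel (\<Union>p\<in>ends ` \<E>. {fst p<..<snd p})"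
          by (rule nonoverlapping_length[OF D])
        also have "\<dots> = measure lebesgue (\<Union>p\<in>ends ` \<E>. {fst p<..<snd p})"
          by (rule measure_completion[symmetric]) (use \<E> in auto)
        also have "\<dots> \<le> measure lebesgue (\<Union>\<D>)"
        proof (rule measure_mono_fmeasurable)
          have "{Inf K<..<Sup K} \<subseteq> K" if "K \<in> \<E>" for K
            using K(2)[of K] that \<E>(1) greaterThanLessThan_subseteq_atLeastAtMost_iff by blast
          then show "(\<Union>p\<in>ends ` \<E>. {fst p<..<snd p}) \<subseteq> \<Union>\<D>"
            using \<E>(1) by (auto simp: ends_def)
        qed (use \<E> \<D>(6) in auto)
        also have "\<dots> < \<delta>"
          using \<D>(7) S'(2) \<delta>(1) by simp
        finally have "(\<Sum>p\<in>ends ` \<E>. G (snd p) - G (fst p)) \<le> \<epsilon>"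
          by (intro \<delta>(2)[OF D])
        then have "(\<Sum>K\<in>\<E>. G (Sup K) - G (Inf K)) \<le> \<epsilon>"
          by (subst (asm) sum.reindex[OF inj]) (simp add: ends_def)
        moreover have "measure M (\<Union>\<E>) \<le> (\<Sum>K\<in>\<E>. measure M K)"
        proof -
          have "K \<in> sets M" if "K \<in> \<E>" for K
            using K(2)[of K] that \<E>(1) by (metis \<open>sets M = sets borel\<close> atLeastAtMost_borel subsetD)
          then show ?thesis
            using measure_UNION_le[OF \<E>(2), of "\<lambda>K. K" M] by simp
        qed
        moreover have "measure M K = G (Sup K) - G (Inf K)" if "K \<in> \<E>" for K
        proof -
          have KD: "K \<in> \<D>" using that \<E>(1) by blast
          have "emeasure M K = ennreal (G (Sup K) - G (Inf K))"
            using M_Icc[of "Inf K" "Sup K"] K[OF KD] H_eq[of "Inf K"] H_eq[of "Sup K"] by simp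
          then show ?thesis
            using mono[of "Inf K" "Sup K"] K[OF KD] by (simp add: measure_def)
        qed
        ultimately show ?thesis by simp
      qed
      have fm: "K \<in> fmeasurable M" if "K \<in> \<D>" for K
        using M_Icc[of "Inf K" "Sup K"] K[OF that]
        by (metis \<open>sets M = sets borel\<close> atLeastAtMost_borel ennreal_less_top fmeasurableI infinity_ennreal_def less_imp_le)
      have T: "\<Union>\<D> \<in> fmeasurable M" "measure M (\<Union>\<D>) \<le> \<epsilon>"
        using fmeasurable_Union_bound[OF \<D>(1) fm fin] measure_Union_bound[OF \<D>(1) fm fin] by blast+
      have "emeasure M S \<le> emeasure M (\<Union>\<D>)"
        using T(1) \<D>(5) by (intro emeasure_mono) auto
      also have "\<dots> \<le> ennreal \<epsilon>"
        using T by (simp add: emeasure_eq_measure2 ennreal_leI)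
      finally show ?thesis by simp
    qed
    have "emeasure M S \<le> 0"
      by (rule ennreal_le_epsilon) (rule le)
    then show "A \<in> null_sets N"
      using A by (auto simp: null_sets_def N_eq S_def)
  qed
  obtain q where q: "q \<in> borel_measurable lborel" "density lborel q = N"
    using sigma_finite_measure.Radon_Nikodym[OF sigma_finite_lborel ac_N] by auto
  have q_int: "(\<integral>\<^sup>+t. q t * indicator A t \<partial>lborel) = emeasure N A" if "A \<in> sets borel" for A
    using q that by (simp add: emeasure_density flip: q(2))
  have "(\<integral>\<^sup>+t. q t \<partial>lborel) = ennreal (H v - H u)"
    using q_int[of UNIV] N_eq[of UNIV] M_Icc[of u v] \<open>u < v\<close> by simp
  then have q_fin: "AE t in lborel. q t \<noteq> \<infinity>"
    using q(1) by (intro nn_integral_PInf_AE) auto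
  define p where "p t = enn2real (q t)" for t
  have p_meas [measurable]: "p \<in> borel_measurable borel"
    using q(1) unfolding p_def by simp
  have p_nonneg: "0 \<le> p t" for t
    by (simp add: p_def)
  have pq: "AE t in lborel. ennreal (p t) = q t"
    using q_fin by eventually_elim (auto simp: p_def less_top)
  have "(\<integral>\<^sup>+t. ennreal (p t) \<partial>lborel) = (\<integral>\<^sup>+t. q t \<partial>lborel)"
    using pq by (rule nn_integral_cong_AE)
  then have int_p: "integrable lborel p"
    using \<open>(\<integral>\<^sup>+t. q t \<partial>lborel) = ennreal (H v - H u)\<close>
    by (intro integrableI_nonneg) (auto simp: p_nonneg)
  moreover have "G y - G x = (LBINT t:{x..y}. p t)" if "u \<le> x" "x \<le> y" "y \<le> v" for x y
  proof -
    have "(LBINT t:{x..y}. p t) = enn2real (\<integral>\<^sup>+t. ennreal (indicator {x..y} t * p t) \<partial>lborel)"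
      unfolding set_lebesgue_integral_def
      by (subst integral_eq_nn_integral) (auto simp: p_nonneg)
    also have "(\<integral>\<^sup>+t. ennreal (indicator {x..y} t * p t) \<partial>lborel) = (\<integral>\<^sup>+t. q t * indicator {x..y} t \<partial>lborel)"
    proof (rule nn_integral_cong_AE)
      show "AE t in lborel. ennreal (indicator {x..y} t * p t) = q t * indicator {x..y} t"
        using pq by eventually_elim (simp split: split_indicator)
    qed
    also have "\<dots> = ennreal (H y - H x)"
      using that by (subst q_int) (auto simp: N_eq M_Icc Int_absorb2)
    also have "enn2real \<dots> = G y - G x"
      using that H_mono[of x y] by (simp add: H_eq)
    finally show ?thesis ..
  qed
  ultimately show thesis
    by (rule that)
qed

text \<open>Jordan decomposition \<open>g = V - W\<close>: increments of \<open>g\<close> are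
  dominated by those of \<open>V\<close>, which makes \<open>W\<close> nondecreasing and lets it
  inherit absolute continuity from \<open>V\<close>.\<close>

theorem abs_continuous_density:
  assumes ac: "abs_continuous_on_interval u v g" and "u < v"
  obtains p where "integrable lborel p"
    "\<And>x y. u \<le> x \<Longrightarrow> x \<le> y \<Longrightarrow> y \<le> v \<Longrightarrow> g y - g x = (LBINT t:{x..y}. p t)"
proof -
  define V where "V x = enn2real (variation g u x)" for x
  have V: "ennreal (V y - V x) = variation g x y" "V x \<le> V y" if "u \<le> x" "x \<le> y" "y \<le> v" for x y
  proof -
    have "ennreal (V y) = ennreal (V x) + variation g x y"
      using variation_additive[OF that(1,2), of g] variation_finite[OF ac, of u x] variation_finite[OF ac, of u y] that
      by (simp add: V_def less_top)
    moreover have nn: "V x \<ge> 0" for x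
      by (simp add: V_def)
    moreover have "variation g x y < \<infinity>"
      using variation_finite[OF ac] that by simp
    then obtain r where "variation g x y = ennreal r" "r \<ge> 0"
      by (cases "variation g x y") auto
    ultimately have "V y = V x + r"
      by (metis add_nonneg_nonneg ennreal_inj ennreal_plus)
    then show "ennreal (V y - V x) = variation g x y" "V x \<le> V y"
      using \<open>variation g x y = ennreal r\<close> \<open>r \<ge> 0\<close> by simp_all
  qed
  have inc: "\<bar>g y - g x\<bar> \<le> V y - V x" if "u \<le> x" "x \<le> y" "y \<le> v" for x y
  proof -
    have "ennreal \<bar>g y - g x\<bar> \<le> ennreal (V y - V x)"
      unfolding V(1)[OF that] by (rule increment_le_variation[OF that(2)])
    then show ?thesis
      using V(2)[OF that] by simp
  qed
  have V_ac: "\<exists>\<delta>>0. \<forall>D. nonoverlapping u v D \<longrightarrow> (\<Sum>p\<in>D. snd p - fst p) < \<delta> \<longrightarrow>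
      (\<Sum>p\<in>D. V (snd p) - V (fst p)) \<le> \<epsilon>" if \<epsilon>: "\<epsilon> > 0" for \<epsilon>
  proof -
    obtain \<delta> where \<delta>: "\<delta> > 0"
      "\<And>D. nonoverlapping u v D \<Longrightarrow> (\<Sum>p\<in>D. snd p - fst p) < \<delta> \<Longrightarrow>
        (\<Sum>p\<in>D. variation g (fst p) (snd p)) \<le> ennreal \<epsilon>"
      using abs_continuous_sum_variation[OF ac \<epsilon>] by blast
    have "(\<Sum>p\<in>D. V (snd p) - V (fst p)) \<le> \<epsilon>"
      if D: "nonoverlapping u v D" "(\<Sum>p\<in>D. snd p - fst p) < \<delta>" for D
    proof -
      have mem: "u \<le> fst p" "fst p \<le> snd p" "snd p \<le> v" if "p \<in> D" for p
        using nonoverlapping_mem[OF D(1) that] by auto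
      have "ennreal (\<Sum>p\<in>D. V (snd p) - V (fst p)) = (\<Sum>p\<in>D. ennreal (V (snd p) - V (fst p)))"
        using V(2)[OF mem] by (intro sum_ennreal[symmetric]) simp
      also have "\<dots> = (\<Sum>p\<in>D. variation g (fst p) (snd p))"
        by (intro sum.cong refl V(1) mem)
      also have "\<dots> \<le> ennreal \<epsilon>"
        by (rule \<delta>(2)[OF D])
      finally show ?thesis
        using \<open>\<epsilon> > 0\<close> by simp
    qed
    with \<delta>(1) show ?thesis by blast
  qed
  obtain p1 where p1: "integrable lborel p1"
    "\<And>x y. u \<le> x \<Longrightarrow> x \<le> y \<Longrightarrow> y \<le> v \<Longrightarrow> V y - V x = (LBINT t:{x..y}. p1 t)"
    using mono_abs_continuous_density[OF \<open>u < v\<close> V(2) V_ac] by blast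
  define W where "W x = V x - g x" for x
  have W_mono: "W x \<le> W y" if "u \<le> x" "x \<le> y" "y \<le> v" for x y
    using inc[OF that] by (simp add: W_def)
  have W_ac: "\<exists>\<delta>>0. \<forall>D. nonoverlapping u v D \<longrightarrow> (\<Sum>p\<in>D. snd p - fst p) < \<delta> \<longrightarrow>
      (\<Sum>p\<in>D. W (snd p) - W (fst p)) \<le> \<epsilon>" if \<epsilon>: "\<epsilon> > 0" for \<epsilon>
  proof -
    obtain \<delta> where \<delta>: "\<delta> > 0" "\<And>D. nonoverlapping u v D \<Longrightarrow> (\<Sum>p\<in>D. snd p - fst p) < \<delta> \<Longrightarrow>
        (\<Sum>p\<in>D. V (snd p) - V (fst p)) \<le> \<epsilon> / 2"
      using V_ac[OF half_gt_zero[OF \<epsilon>]] by blast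
    have "(\<Sum>p\<in>D. W (snd p) - W (fst p)) \<le> \<epsilon>"
      if D: "nonoverlapping u v D" "(\<Sum>p\<in>D. snd p - fst p) < \<delta>" for D
    proof -
      \<comment> \<open>An increment of \<open>W\<close> is one of \<open>V\<close> plus at most
        another one, which accounts for the \<open>\<epsilon> / 2\<close> in the choice of
        \<open>\<delta>\<close>.\<close>
      have "W (snd p) - W (fst p) \<le> 2 * (V (snd p) - V (fst p))" if "p \<in> D" for p
        using inc[of "fst p" "snd p"] nonoverlapping_mem[OF D(1) that] by (simp add: W_def)
      then have "(\<Sum>p\<in>D. W (snd p) - W (fst p)) \<le> (\<Sum>p\<in>D. 2 * (V (snd p) - V (fst p)))"
        by (rule sum_mono)
      also have "\<dots> = 2 * (\<Sum>p\<in>D. V (snd p) - V (fst p))"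
        by (rule sum_distrib_left[symmetric])
      finally show ?thesis
        using \<delta>(2)[OF D] by linarith
    qed
    with \<delta>(1) show ?thesis by blast
  qed
  obtain p2 where p2: "integrable lborel p2"
    "\<And>x y. u \<le> x \<Longrightarrow> x \<le> y \<Longrightarrow> y \<le> v \<Longrightarrow> W y - W x = (LBINT t:{x..y}. p2 t)"
    using mono_abs_continuous_density[OF \<open>u < v\<close> W_mono W_ac] by blast
  have "g y - g x = (LBINT t:{x..y}. p1 t - p2 t)" if "u \<le> x" "x \<le> y" "y \<le> v" for x y
  proof -
    have "set_integrable lborel {x..y} p1" "set_integrable lborel {x..y} p2"
      using p1(1) p2(1) unfolding set_integrable_def by (auto intro!: integrable_mult_indicator simp del: real_scaleR_def)
    then have "(LBINT t:{x..y}. p1 t - p2 t) = (V y - V x) - (W y - W x)"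
      using p1(2)[OF that] p2(2)[OF that] by simp
    then show ?thesis
      by (simp add: W_def)
  qed
  then show thesis
    using p1(1) p2(1) by (intro that[of "\<lambda>t. p1 t - p2 t"]) auto
qed

section \<open>Pointwise derivatives of locally absolutely continuous functions\<close>

lemma locally_abs_continuous_imp_continuous:
  assumes "locally_abs_continuous g"
  shows "continuous_on UNIV g"
  unfolding continuous_on_iff
proof (intro ballI allI impI)
  fix x e :: real assume "e > 0"
  have ac: "abs_continuous_on_interval (x - 1) (x + 1) g"
    using assms unfolding locally_abs_continuous_def by simp
  obtain \<delta> where \<delta>: "\<delta> > 0" "\<And>D. nonoverlapping (x - 1) (x + 1) D \<Longrightarrow> (\<Sum>p\<in>D. snd p - fst p) < \<delta> \<Longrightarrow>
      total_increment g D \<le> ennreal (e / 2)"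
    using abs_continuous_total_increment[OF ac, of "e / 2"] \<open>e > 0\<close> by auto
  have close: "\<bar>g t - g s\<bar> < e" if "x - 1 \<le> s" "s < t" "t \<le> x + 1" "t - s < \<delta>" for s t
    using \<delta>(2)[OF nonoverlapping_single, of s t] that \<open>e > 0\<close> by (simp add: total_increment_def)
  have "dist (g y) (g x) < e" if "dist y x < min \<delta> 1" for y
  proof (cases y x rule: linorder_cases)
    case less
    then show ?thesis
      using close[of y x] that by (simp add: dist_real_def abs_minus_commute)
  next
    case greater
    then show ?thesis
      using close[of x y] that by (simp add: dist_real_def)
  qed (use \<open>e > 0\<close> in simp)
  then show "\<exists>d>0. \<forall>x'\<in>UNIV. dist x' x < d \<longrightarrow> dist (g x') (g x) < e"
    using \<delta>(1) by (intro exI[of _ "min \<delta> 1"]) auto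
qed

text \<open>The derivative need not be integrable on the whole line, so integrability and the
  fundamental theorem are stated on compact intervals. The densities on growing intervals are glued
  through the pointwise derivative.\<close>

theorem locally_abs_continuous_derivative:
  assumes g: "locally_abs_continuous g"
  obtains p where "p \<in> borel_measurable borel" "AE x in lborel. (g has_real_derivative p x) (at x)"
    "\<And>u v. set_integrable lborel {u..v} p"
    "\<And>u v. u \<le> v \<Longrightarrow> g v - g u = (LBINT t:{u..v}. p t)"
proof -
  have cont: "continuous_on UNIV g"
    using g by (rule locally_abs_continuous_imp_continuous)
  then have [measurable]: "g \<in> borel_measurable borel"
    by (rule borel_measurable_continuous_onI)
  have "\<forall>n. \<exists>p. integrable lborel p \<and> (\<forall>x y. - real (Suc n) \<le> x \<longrightarrow> x \<le> y \<longrightarrow> y \<le> real (Suc n) \<longrightarrow>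
      g y - g x = (LBINT t:{x..y}. p t))"
  proof
    fix n
    have "abs_continuous_on_interval (- real (Suc n)) (real (Suc n)) g"
      using g unfolding locally_abs_continuous_def by simp
    then show "\<exists>p. integrable lborel p \<and> (\<forall>x y. - real (Suc n) \<le> x \<longrightarrow> x \<le> y \<longrightarrow> y \<le> real (Suc n) \<longrightarrow>
      g y - g x = (LBINT t:{x..y}. p t))"
      by (rule abs_continuous_density) auto
  qed
  then obtain P where P: "\<And>n. integrable lborel (P n)"
    "\<And>n x y. - real (Suc n) \<le> x \<Longrightarrow> x \<le> y \<Longrightarrow> y \<le> real (Suc n) \<Longrightarrow> g y - g x = (LBINT t:{x..y}. P n t)"
    by metis
  \<comment> \<open>The \<open>P n\<close> match each other only almost everywhere. The limit along
    \<open>1 / (n + 1)\<close> is a single Borel function on the line that equals the derivative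
    wherever the derivative exists.\<close>
  define p where "p x = lim (\<lambda>n. (g (x + inverse (real (Suc n))) - g x) / inverse (real (Suc n)))" for x
  have p_meas [measurable]: "p \<in> borel_measurable borel"
    unfolding p_def by measurable
  have p_eq: "p x = D" if "(g has_real_derivative D) (at x)" for x D
  proof -
    have "((\<lambda>h. (g (x + h) - g x) / h) \<longlongrightarrow> D) (at 0)"
      using that by (simp add: DERIV_def)
    moreover have "filterlim (\<lambda>n. inverse (real (Suc n))) (at 0) sequentially"
      using LIMSEQ_inverse_real_of_nat by (auto simp: filterlim_at)
    ultimately have "(\<lambda>n. (g (x + inverse (real (Suc n))) - g x) / inverse (real (Suc n))) \<longlonglongrightarrow> D"
      by (rule filterlim_compose)
    then show ?thesis
      unfolding p_def by (rule limI)
  qed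
  have "AE x in lborel. x \<in> {- real (Suc n)<..<real (Suc n)} \<longrightarrow> (g has_real_derivative P n x) (at x)" for n
    by (rule lebesgue_differentiation) (use P continuous_on_subset[OF cont] in auto)
  then have AE: "AE x in lborel. \<forall>n. x \<in> {- real (Suc n)<..<real (Suc n)} \<longrightarrow> (g has_real_derivative P n x) (at x)"
    by (subst AE_all_countable) blast
  show thesis
  proof
    show "p \<in> borel_measurable borel" by fact
    show "AE x in lborel. (g has_real_derivative p x) (at x)"
      using AE
    proof eventually_elim
      case (elim x)
      obtain n where "\<bar>x\<bar> < real n"
        using reals_Archimedean2 by blast
      then have "(g has_real_derivative P n x) (at x)"
        using elim[rule_format, of n] by (auto simp: abs_less_iff)
      then show ?case
        using p_eq by simp
    qed
    have local: "set_integrable lborel {u..v} p \<and> (u \<le> v \<longrightarrow> g v - g u = (LBINT t:{u..v}. p t))" for u v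
    proof -
      obtain n where n: "max \<bar>u\<bar> \<bar>v\<bar> < real n"
        using reals_Archimedean2 by blast
      have eq: "AE x in lborel. indicat_real {u..v} x *\<^sub>R P n x = indicat_real {u..v} x *\<^sub>R p x"
        using AE
      proof eventually_elim
        case (elim x)
        show ?case
          using elim[rule_format, of n] n p_eq[of "P n x" x] by (auto simp: abs_less_iff split: split_indicator)
      qed
      have m: "(\<lambda>x. indicat_real {u..v} x *\<^sub>R P n x) \<in> borel_measurable lborel"
        using P(1)[of n] by measurable
      have "integrable lborel (\<lambda>x. indicat_real {u..v} x *\<^sub>R P n x)"
        using P(1)[of n] by (intro integrable_mult_indicator) auto
      then have "set_integrable lborel {u..v} p"
        unfolding set_integrable_def using eq m by (subst integrable_cong_AE[symmetric]) auto
      moreover have "(LBINT t:{u..v}. p t) = (LBINT t:{u..v}. P n t)"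
        unfolding set_lebesgue_integral_def using eq m
        by (intro integral_cong_AE) auto
      ultimately show ?thesis
        using P(2)[of n u v] n by auto
    qed
    show "set_integrable lborel {u..v} p" for u v
      using local by blast
    show "g v - g u = (LBINT t:{u..v}. p t)" if "u \<le> v" for u v
      using local that by blast
  qed
qed


section \<open>Measures with a positive density\<close>

locale positive_density =
  fixes \<mu> :: "real measure" and f :: "real \<Rightarrow> real"
  assumes prob: "prob_space \<mu>"
    and f_meas [measurable]: "f \<in> borel_measurable borel"
    and f_pos: "\<And>x. f x > 0"
    and density_eq: "\<mu> = density lborel (\<lambda>x. ennreal (f x))"
begin

sublocale real_distribution \<mu>
  using prob by (auto simp: real_distribution_def real_distribution_axioms_def density_eq)

abbreviation "F \<equiv> cdf \<mu>"
definition \<phi> :: "real \<Rightarrow> real" where "\<phi> x = min (F x) (1 - F x)"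
text \<open>The function H of the overview; the centering is built in, so \<open>h\<close> itself is
  the argument.\<close>

definition tail_integral :: "(real \<Rightarrow> real) \<Rightarrow> real \<Rightarrow> real" where
  "tail_integral h t = (LINT y:{..t}|\<mu>. centered \<mu> h y)"

text \<open>Positivity of \<open>f\<close> gives \<mu> and Lebesgue measure the same null sets, so
  almost-everywhere statements on derivatives and on \<open>T_op\<close> move freely between
  them.\<close>

lemma AE_mu: "(AE x in \<mu>. P x) \<longleftrightarrow> (AE x in lborel. P x)"
  unfolding density_eq by (subst AE_density) (auto simp: f_pos)

lemma nn_integral_mu: "g \<in> borel_measurable borel \<Longrightarrow> (\<integral>\<^sup>+x. g x \<partial>\<mu>) = (\<integral>\<^sup>+x. ennreal (f x) * g x \<partial>lborel)"
  unfolding density_eq by (subst nn_integral_density) auto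

text \<open>Nonempty open sets have positive Lebesgue measure. This turns almost-everywhere bounds
  on continuous functions into bounds at every point.\<close>

lemma AE_imp_open_empty:
  assumes "AE x in lborel. x \<notin> U" "open U"
  shows "U = {}"
proof (rule ccontr)
  assume "U \<noteq> {}"
  have "U \<in> null_sets lborel"
    using assms by (subst AE_iff_null_sets) auto
  then have "negligible U"
    by (simp add: negligible_iff_null_sets null_sets_completionI)
  then show False
    using open_not_negligible assms(2) \<open>U \<noteq> {}\<close> by blast
qed

lemma measure_open_pos:
  assumes "open U" "U \<noteq> {}"
  shows "0 < measure \<mu> U"
proof (rule ccontr)
  assume "\<not> 0 < measure \<mu> U"
  then have "measure \<mu> U = 0"
    using measure_nonneg[of \<mu> U] by linarith
  then have "U \<in> null_sets \<mu>"
    using assms by (auto simp: null_sets_def emeasure_eq_measure)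
  then have "AE x in \<mu>. x \<notin> U"
    by (rule AE_not_in)
  then show False
    using AE_imp_open_empty[of U] assms by (simp add: AE_mu)
qed

lemma integrable_f: "integrable lborel f"
proof -
  have "emeasure \<mu> UNIV = (\<integral>\<^sup>+x. ennreal (f x) \<partial>lborel)"
    unfolding density_eq by (subst emeasure_density) auto
  moreover have "emeasure \<mu> UNIV = 1"
    using emeasure_space_1 by simp
  ultimately show ?thesis
    using f_pos by (intro integrableI_nonneg) (auto simp: less_imp_le)
qed

lemma measure_mu: "A \<in> sets borel \<Longrightarrow> measure \<mu> A = (LBINT t:A. f t)"
proof -
  assume [measurable]: "A \<in> sets borel"
  have "(LBINT t:A. f t) = enn2real (\<integral>\<^sup>+x. ennreal (indicator A x * f x) \<partial>lborel)"
    unfolding set_lebesgue_integral_def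
    by (subst integral_eq_nn_integral) (auto simp: f_pos less_imp_le)
  also have "(\<integral>\<^sup>+x. ennreal (indicator A x * f x) \<partial>lborel) = emeasure \<mu> A"
    unfolding density_eq by (subst emeasure_density) (auto intro!: nn_integral_cong split: split_indicator)
  finally show ?thesis
    by (simp add: measure_def)
qed

lemma measure_singleton [simp]: "measure \<mu> {x} = 0"
proof -
  have "AE t in lborel. t \<noteq> x"
    by (rule AE_lborel_singleton)
  then have "AE t in lborel. indicator {x} t *\<^sub>R f t = 0"
    by eventually_elim simp
  then show ?thesis
    by (simp add: measure_mu set_lebesgue_integral_def integral_eq_zero_AE)
qed

section \<open>The distribution function, its median, and the operator at the median\<close>

lemma F_cont: "continuous_on UNIV F"
  by (simp add: continuous_on_eq_continuous_at isCont_cdf)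

lemma F_diff: "x \<le> y \<Longrightarrow> F y - F x = measure \<mu> {x<..y}"
  by (cases "x = y") (auto simp: cdf_diff_eq)

lemma F_diff_Icc: "x \<le> y \<Longrightarrow> F y - F x = (LBINT t:{x..y}. f t)"
proof -
  assume "x \<le> y"
  have "measure \<mu> {x..y} = measure \<mu> {x} + measure \<mu> {x<..y}"
    using \<open>x \<le> y\<close> by (subst finite_measure_Union[symmetric]) (auto intro!: arg_cong[where f="measure \<mu>"])
  then show ?thesis
    using \<open>x \<le> y\<close> by (simp add: F_diff measure_mu)
qed

lemma F_strict_mono: "x < y \<Longrightarrow> F x < F y"
proof -
  assume "x < y"
  have "0 < measure \<mu> {x<..<y}"
    using \<open>x < y\<close> by (intro measure_open_pos) auto
  also have "\<dots> \<le> measure \<mu> {x<..y}"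
    by (intro finite_measure_mono) auto
  finally show ?thesis
    using F_diff[of x y] \<open>x < y\<close> by simp
qed

lemma F_pos: "0 < F x"
  using F_strict_mono[of "x - 1" x] cdf_nonneg[of "x - 1"] by linarith

lemma F_less_1: "F x < 1"
  using F_strict_mono[of x "x + 1"] cdf_bounded_prob[of "x + 1"] by linarith

lemma \<phi>_pos: "0 < \<phi> x"
  using F_pos F_less_1 by (simp add: \<phi>_def)

lemma measure_greaterThan: "measure \<mu> {x<..} = 1 - F x"
proof -
  have "measure \<mu> (space \<mu> - {..x}) = 1 - measure \<mu> {..x}"
    by (rule prob_compl) simp
  then show ?thesis
    by (simp add: cdf_def Compl_eq_Diff_UNIV[symmetric])
qed

lemma measure_atLeast: "measure \<mu> {x..} = 1 - F x"
proof -
  have "{x..} = {x} \<union> {x<..}" by auto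
  then have "measure \<mu> {x..} = measure \<mu> {x} + measure \<mu> {x<..}"
    by (simp only:) (rule finite_measure_Union; auto)
  then show ?thesis
    by (simp add: measure_greaterThan)
qed

text \<open>\<open>F\<close> is continuous and strictly increasing, so it takes the value 1/2
  exactly once; the definite description in \<open>median\<close> therefore denotes.\<close>

lemma F_median: "F (median \<mu>) = 1 / 2"
proof -
  have "\<forall>\<^sub>F x in at_bot. F x < 1 / 2"
    by (rule order_tendstoD[OF cdf_lim_at_bot]) simp
  then obtain a where a: "F a < 1 / 2"
    by (auto simp: eventually_at_bot_linorder)
  have "\<forall>\<^sub>F x in at_top. F x > 1 / 2"
    by (rule order_tendstoD[OF cdf_lim_at_top_prob]) simp
  then obtain b where b: "F b > 1 / 2"
    by (auto simp: eventually_at_top_linorder)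
  have "a \<le> b"
    using a b F_strict_mono[of b a] by (cases "a \<le> b") auto
  then obtain m where m: "F m = 1 / 2"
    using IVT'[of F a "1/2" b] a b F_cont continuous_on_subset by (metis less_imp_le subset_UNIV)
  have "median \<mu> = m"
    unfolding median_def
  proof (rule the_equality)
    show "1 / 2 \<le> measure \<mu> {..m} \<and> 1 / 2 \<le> measure \<mu> {m..}"
      using m by (simp add: measure_atLeast) (simp add: cdf_def)
    fix m' assume "1 / 2 \<le> measure \<mu> {..m'} \<and> 1 / 2 \<le> measure \<mu> {m'..}"
    then have "F m' = 1 / 2"
      by (simp add: measure_atLeast) (simp add: cdf_def)
    then show "m' = m"
      using m F_strict_mono[of m m'] F_strict_mono[of m' m] by (cases m m' rule: linorder_cases) auto
  qed
  with m show ?thesis by simp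
qed

lemma \<phi>_eq: "\<phi> x = (if x \<le> median \<mu> then F x else 1 - F x)"
proof (cases x "median \<mu>" rule: linorder_cases)
  case less
  then show ?thesis
    using F_strict_mono[of x "median \<mu>"] F_median by (simp add: \<phi>_def)
next
  case greater
  then show ?thesis
    using F_strict_mono[of "median \<mu>" x] F_median by (simp add: \<phi>_def)
qed (simp add: \<phi>_def F_median)

lemma lower_endpoint_eq: "lower_endpoint \<mu> = - \<infinity>"
  unfolding lower_endpoint_def by (rule ereal_bot) (auto simp: F_pos intro!: Inf_lower)

lemma upper_endpoint_eq: "upper_endpoint \<mu> = \<infinity>"
  unfolding upper_endpoint_def by (rule ereal_top) (auto simp: F_less_1 intro!: Sup_upper)

text \<open>The endpoints are infinite, so the guard in \<open>T_op\<close> always holds. Splitting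
  at the median gives both branches the same denominator \<open>\<phi>\<close>, which is
  \<open>F\<close> on the left and \<open>1 - F\<close> on the right.\<close>

lemma T_op_eq: "T_op \<mu> (ereal (median \<mu>)) h x =
   (if x \<le> median \<mu> then (LINT y:{..x}|\<mu>. h y) else (LINT y:{x<..}|\<mu>. h y)) / \<phi> x"
proof -
  have "{y. - \<infinity> < ereal y \<and> y \<le> x} = {..x}" "{y. x < y \<and> ereal y < \<infinity>} = {x<..}"
    by auto
  then show ?thesis
    by (simp add: T_op_def lower_endpoint_eq upper_endpoint_eq \<phi>_eq)
qed

lemma T_op_measurable [measurable]:
  assumes [measurable]: "h \<in> borel_measurable borel"
  shows "T_op \<mu> (ereal (median \<mu>)) h \<in> borel_measurable borel"
proof -
  have [measurable]: "F \<in> borel_measurable borel"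
    using F_cont by (rule borel_measurable_continuous_onI)
  have [measurable]: "\<phi> \<in> borel_measurable borel"
    unfolding \<phi>_def by measurable
  \<comment> \<open>With the bound moved into the integrand, both are integrals of functions of two
    variables against the fixed \<mu>, and measurability in \<open>x\<close> follows as in Fubini's
    theorem.\<close>
  have eq: "(LINT y:{..x}|\<mu>. h y) = (LINT y|\<mu>. (if y \<le> x then h y else 0))"
    "(LINT y:{x<..}|\<mu>. h y) = (LINT y|\<mu>. (if x < y then h y else 0))" for x
    unfolding set_lebesgue_integral_def by (auto intro!: Bochner_Integration.integral_cong)
  show ?thesis
    unfolding T_op_eq[abs_def] eq by measurable
qed

lemma centered_integrable: "integrable \<mu> h \<Longrightarrow> integrable \<mu> (centered \<mu> h)"
  unfolding centered_def[abs_def] by simp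

lemma centered_integral: "integrable \<mu> h \<Longrightarrow> (\<integral>x. centered \<mu> h x \<partial>\<mu>) = 0"
  unfolding centered_def[abs_def] using prob_space by simp

text \<open>The two tails of a centered function add up to 0. Hence both branches of the operator
  are, up to sign, the same tail integral divided by \<open>\<phi>\<close>.\<close>

lemma upper_tail_integral:
  assumes h: "integrable \<mu> h"
  shows "(LINT y:{t<..}|\<mu>. centered \<mu> h y) = - tail_integral h t"
proof -
  let ?h = "centered \<mu> h"
  have "set_integrable \<mu> {..t} ?h" "set_integrable \<mu> {t<..} ?h"
    unfolding set_integrable_def using centered_integrable[OF h]
    by (auto intro!: integrable_mult_indicator simp del: real_scaleR_def)
  then have "(LINT y:{..t} \<union> {t<..}|\<mu>. ?h y) = tail_integral h t + (LINT y:{t<..}|\<mu>. ?h y)"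
    unfolding tail_integral_def by (intro set_integral_Un) auto
  moreover have "{..t} \<union> {t<..} = UNIV"
    by auto
  ultimately show ?thesis
    using centered_integral[OF h] by (simp add: set_lebesgue_integral_def)
qed

lemma abs_tail_integral:
  assumes h: "integrable \<mu> h"
  shows "\<bar>tail_integral h t\<bar> = \<phi> t * \<bar>T_op \<mu> (ereal (median \<mu>)) (centered \<mu> h) t\<bar>"
  using \<phi>_pos[of t] upper_tail_integral[OF h, of t]
  by (auto simp: T_op_eq tail_integral_def)

section \<open>Boundary measures of half-lines and the isoperimetric constant\<close>

lemma F_derivative: "AE x in lborel. (F has_real_derivative f x) (at x)"
proof -
  have "AE x in lborel. x \<in> {- real n<..<real n} \<longrightarrow> (F has_real_derivative f x) (at x)" for n
    by (rule lebesgue_differentiation[OF integrable_f]) (use F_diff_Icc continuous_on_subset[OF F_cont] in auto)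
  then have "AE x in lborel. \<forall>n. x \<in> {- real n<..<real n} \<longrightarrow> (F has_real_derivative f x) (at x)"
    by (subst AE_all_countable) blast
  then show ?thesis
  proof eventually_elim
    case (elim x)
    obtain n where "\<bar>x\<bar> < real n"
      using reals_Archimedean2 by blast
    then show ?case
      using elim[rule_format, of n] by (auto simp: abs_less_iff)
  qed
qed

text \<open>The enlargement is an open half-line, and \<mu> has no atoms, so the quotient in the
  liminf is the right difference quotient of \<open>F\<close>.\<close>

lemma boundary_measure_atMost:
  assumes "(F has_real_derivative D) (at x)"
  shows "boundary_measure \<mu> {..x} = ennreal D"
proof -
  have eq: "measure \<mu> (enlargement {..x} h) - measure \<mu> {..x} = F (x + h) - F x" if "h > 0" for h
  proof -
    have "enlargement {..x} h = {..<x + h}"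
    proof (intro set_eqI iffI)
      fix y assume "y \<in> {..<x + h}"
      then have "\<bar>y - min x y\<bar> < h" "min x y \<in> {..x}"
        using that by (auto simp: min_def)
      then show "y \<in> enlargement {..x} h"
        unfolding enlargement_def by blast
    qed (auto simp: enlargement_def)
    moreover have "{..x + h} = {..<x + h} \<union> {x + h}"
      by auto
    then have "measure \<mu> {..x + h} = measure \<mu> {..<x + h} + measure \<mu> {x + h}"
      by (simp only:) (rule finite_measure_Union; auto)
    ultimately show ?thesis
      by (simp add: cdf_def)
  qed
  have "((\<lambda>h. (F (x + h) - F x) / h) \<longlongrightarrow> D) (at_right 0)"
    using assms unfolding DERIV_def by (rule tendsto_mono[rotated]) (simp add: at_le)
  then have "((\<lambda>h. (measure \<mu> (enlargement {..x} h) - measure \<mu> {..x}) / h) \<longlongrightarrow> D) (at_right 0)"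
    by (rule Lim_transform_eventually) (auto simp: eventually_at_right_less eq intro!: eventually_mono[OF eventually_at_right_less[of 0]])
  then have "((\<lambda>h. ennreal ((measure \<mu> (enlargement {..x} h) - measure \<mu> {..x}) / h)) \<longlongrightarrow> ennreal D) (at_right 0)"
    by (rule tendsto_ennrealI)
  then show ?thesis
    unfolding boundary_measure_def by (intro lim_imp_Liminf) auto
qed

text \<open>Multiplication by a fixed factor commutes with suprema in \<open>ennreal\<close>, so the
  supremum that defines \<open>Is\<close> is itself an admissible constant.\<close>

lemma Is_le_boundary:
  assumes "A \<in> sets borel"
  shows "Is \<mu> * ennreal (min (measure \<mu> A) (1 - measure \<mu> A)) \<le> boundary_measure \<mu> A"
proof -
  have "Is \<mu> * ennreal (min (measure \<mu> A) (1 - measure \<mu> A))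
    = (SUP c\<in>{c. \<forall>A\<in>sets \<mu>. c * ennreal (min (measure \<mu> A) (1 - measure \<mu> A)) \<le> boundary_measure \<mu> A}.
        c * ennreal (min (measure \<mu> A) (1 - measure \<mu> A)))"
    unfolding Is_def by (subst SUP_mult_right_ennreal[symmetric]) simp
  also have "\<dots> \<le> boundary_measure \<mu> A"
    using assms by (intro SUP_least) auto
  finally show ?thesis .
qed

lemma Is_le_density: "AE x in lborel. Is \<mu> * ennreal (\<phi> x) \<le> ennreal (f x)"
  using F_derivative
proof eventually_elim
  case (elim x)
  then show ?case
    using Is_le_boundary[of "{..x}"] boundary_measure_atMost[OF elim] by (simp add: \<phi>_def cdf_def)
qed

text \<open>One point where the density bound holds is enough, since \<open>\<phi>\<close> is
  positive and \<open>f\<close> finite there. Finiteness is what makes \<open>1 / Is \<mu>\<close> a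
  positive constant.\<close>

lemma Is_finite: "Is \<mu> < \<infinity>"
proof -
  have "\<not> (AE x in lborel. x \<notin> (UNIV :: real set))"
    using AE_imp_open_empty[of UNIV] by auto
  then obtain x where "Is \<mu> * ennreal (\<phi> x) \<le> ennreal (f x)"
    using Is_le_density by (metis (mono_tags, lifting) eventually_mono)
  then show ?thesis
    using \<phi>_pos[of x] by (cases "Is \<mu> = \<infinity>") (auto simp: ennreal_top_mult less_top top_unique)
qed

end


section \<open>Integration by parts and the covariance inequality\<close>

context positive_density
begin

text \<open>Clamping \<open>g\<close> to \<open>[a, b]\<close> makes Fubini's theorem applicable: \<open>\<integral> \<bar>g'(t)\<bar> \<integral>\<^bsub>x > t\<^esub> \<bar>h\<^sub>0\<bar> d\<mu> dt\<close> may be infinite over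
  the whole line.\<close>

lemma integral_clamped_eq:
  assumes p: "\<And>u v. set_integrable lborel {u..v} p" "\<And>u v. u \<le> v \<Longrightarrow> g v - g u = (LBINT t:{u..v}. p t)"
    and h: "integrable \<mu> h" and "a \<le> b"
  shows "(\<integral>x. g (max a (min b x)) * centered \<mu> h x \<partial>\<mu>) = - (LBINT t:{a..b}. p t * tail_integral h t)"
proof -
  let ?h = "centered \<mu> h"
  define q where "q t = indicat_real {a..b} t * p t" for t
  have q: "integrable lborel q"
    using p(1)[of a b] by (simp add: set_integrable_def q_def[abs_def])
  then have [measurable]: "q \<in> borel_measurable borel"
    by auto
  have h0: "integrable \<mu> ?h"
    by (rule centered_integrable[OF h])
  then have [measurable]: "?h \<in> borel_measurable borel"
    by auto
  \<comment> \<open>Integrating \<open>k\<close> over \<open>t\<close> gives the centered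
    \<open>h\<close> times the clamped increment of \<open>g\<close>; integrating over
    \<open>x\<close> gives \<open>- q t * tail_integral h t\<close>. Fubini equates the two.\<close>
  define k where "k x t = ?h x * q t * indicat_real {t<..} x" for x t
  interpret P: pair_sigma_finite \<mu> lborel ..
  have "integrable (\<mu> \<Otimes>\<^sub>M lborel) (\<lambda>(x, t). ?h x * q t)"
  proof (rule P.Fubini_integrable)
    show "integrable \<mu> (\<lambda>x. LINT t|lborel. norm (case (x, t) of (x, t) \<Rightarrow> ?h x * q t))"
      using h0 q by (simp add: abs_mult)
    show "AE x in \<mu>. integrable lborel (\<lambda>t. case (x, t) of (x, t) \<Rightarrow> ?h x * q t)"
      using q by simp
  qed measurable
  then have k_int: "integrable (\<mu> \<Otimes>\<^sub>M lborel) (case_prod k)"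
  proof (rule Bochner_Integration.integrable_bound)
    have "case_prod k = (\<lambda>z. ?h (fst z) * q (snd z) * (if snd z < fst z then 1 else 0))"
      by (auto simp: k_def fun_eq_iff indicator_def)
    then show "case_prod k \<in> borel_measurable (\<mu> \<Otimes>\<^sub>M lborel)"
      by simp
  qed (auto simp: k_def split: split_indicator)
  have increment: "g (max a (min b x)) - g a = (\<integral>t. q t * indicat_real {t<..} x \<partial>lborel)" for x
  proof (cases "a \<le> x")
    case True
    have "g (max a (min b x)) - g a = (LBINT t:{a..min b x}. p t)"
      using p(2)[of a "min b x"] True \<open>a \<le> b\<close> by simp
    also have "\<dots> = (\<integral>t. q t * indicat_real {t<..} x \<partial>lborel)"
      unfolding set_lebesgue_integral_def
    proof (rule integral_cong_AE)
      have "set_integrable lborel {a..min b x} p"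
        by (rule p)
      then show "(\<lambda>t. indicat_real {a..min b x} t *\<^sub>R p t) \<in> borel_measurable lborel"
        unfolding set_integrable_def by simp
      have "(\<lambda>t. q t * indicat_real {t<..} x) = (\<lambda>t. q t * indicat_real {..<x} t)"
        by (auto simp: fun_eq_iff indicator_def)
      then show "(\<lambda>t. q t * indicat_real {t<..} x) \<in> borel_measurable lborel"
        by simp
      \<comment> \<open>The closed interval and the strict condition \<open>t < x\<close> can
        disagree only at \<open>t = x\<close>.\<close>
      show "AE t in lborel. indicat_real {a..min b x} t *\<^sub>R p t = q t * indicat_real {t<..} x"
        using AE_lborel_singleton[of x] by eventually_elim (auto simp: q_def split: split_indicator)
    qed
    finally show ?thesis .
  next
    case False
    then have "(\<lambda>t. q t * indicat_real {t<..} x) = (\<lambda>t. 0)"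
      by (auto simp: q_def fun_eq_iff split: split_indicator)
    then show ?thesis
      using False by simp
  qed
  have "(\<integral>x. k x t \<partial>\<mu>) = - (q t * tail_integral h t)" for t
  proof -
    have "(\<integral>x. k x t \<partial>\<mu>) = (\<integral>x. q t * (indicat_real {t<..} x *\<^sub>R ?h x) \<partial>\<mu>)"
      by (rule Bochner_Integration.integral_cong) (auto simp: k_def)
    also have "\<dots> = q t * (LINT x:{t<..}|\<mu>. ?h x)"
      unfolding set_lebesgue_integral_def by (rule integral_mult_right_zero)
    finally show ?thesis
      by (simp add: upper_tail_integral[OF h])
  qed
  then have "(\<integral>t. (\<integral>x. k x t \<partial>\<mu>) \<partial>lborel) = - (LBINT t:{a..b}. p t * tail_integral h t)"
    by (simp add: q_def set_lebesgue_integral_def mult.assoc)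
  moreover have "(\<integral>t. (\<integral>x. k x t \<partial>\<mu>) \<partial>lborel) = (\<integral>x. (\<integral>t. k x t \<partial>lborel) \<partial>\<mu>)"
    by (rule P.Fubini_integral[OF k_int])
  moreover have "(\<integral>t. k x t \<partial>lborel) = ?h x * (g (max a (min b x)) - g a)" for x
    by (simp add: k_def increment mult.assoc)
  \<comment> \<open>The constant \<open>g a\<close> drops out because the centered function
    integrates to 0.\<close>
  moreover have "(\<integral>x. ?h x * (g (max a (min b x)) - g a) \<partial>\<mu>) = (\<integral>x. g (max a (min b x)) * ?h x \<partial>\<mu>)"
  proof -
    have "integrable \<mu> (\<lambda>x. \<integral>t. k x t \<partial>lborel)"
      using P.integrable_fst[OF k_int] .
    then have 1: "integrable \<mu> (\<lambda>x. ?h x * (g (max a (min b x)) - g a))"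
      by (simp add: k_def increment mult.assoc)
    have "(\<integral>x. g (max a (min b x)) * ?h x \<partial>\<mu>)
        = (\<integral>x. ?h x * (g (max a (min b x)) - g a) + g a * ?h x \<partial>\<mu>)"
      by (rule Bochner_Integration.integral_cong) (auto simp: algebra_simps)
    also have "\<dots> = (\<integral>x. ?h x * (g (max a (min b x)) - g a) \<partial>\<mu>) + g a * (\<integral>x. ?h x \<partial>\<mu>)"
      using 1 h0 by (subst Bochner_Integration.integral_add) auto
    finally show ?thesis
      by (simp add: centered_integral[OF h])
  qed
  ultimately show ?thesis by simp
qed

lemma L1_norm_deriv:
  assumes "p \<in> borel_measurable borel" "AE x in lborel. (g has_real_derivative p x) (at x)"
  shows "L1_norm \<mu> (deriv g) = (\<integral>\<^sup>+x. ennreal (f x) * ennreal \<bar>p x\<bar> \<partial>lborel)"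
proof -
  have "AE x in \<mu>. deriv g x = p x"
    unfolding AE_mu using assms(2) by eventually_elim (rule DERIV_imp_deriv)
  then have "L1_norm \<mu> (deriv g) = (\<integral>\<^sup>+x. ennreal \<bar>p x\<bar> \<partial>\<mu>)"
    unfolding L1_norm_def by (intro nn_integral_cong_AE) (auto elim: eventually_mono)
  also have "\<dots> = (\<integral>\<^sup>+x. ennreal (f x) * ennreal \<bar>p x\<bar> \<partial>lborel)"
    using assms(1) by (intro nn_integral_mu) simp
  finally show ?thesis .
qed

lemma Linf_norm_bounded:
  assumes g: "continuous_on UNIV g" "Linf_norm \<mu> g < \<infinity>"
  obtains B where "\<And>x. \<bar>g x\<bar> \<le> B"
proof -
  obtain B where B: "Linf_norm \<mu> g = ennreal B" "B \<ge> 0"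
    using g(2) by (cases "Linf_norm \<mu> g") auto
  have "AE x in \<mu>. ennreal \<bar>g x\<bar> \<le> ennreal B"
    using esssup_AE[of "\<lambda>x. ennreal \<bar>g x\<bar>" \<mu>] B unfolding Linf_norm_def by simp
  then have "AE x in lborel. x \<notin> {x. B < \<bar>g x\<bar>}"
    using B(2) by (simp add: AE_mu not_less)
  moreover have "open {x. B < \<bar>g x\<bar>}"
    using g(1) by (intro open_Collect_less continuous_intros)
  ultimately have "{x. B < \<bar>g x\<bar>} = {}"
    by (rule AE_imp_open_empty)
  then show thesis
    by (intro that[of B]) (auto simp: not_less[symmetric])
qed

text \<open>The Bochner integral of a non-integrable function is 0 by convention, so the estimate
  holds without an integrability hypothesis.\<close>

lemma integral_abs_le_nn:
  fixes k :: "'b \<Rightarrow> real"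
  shows "ennreal \<bar>\<integral>x. k x \<partial>M\<bar> \<le> (\<integral>\<^sup>+x. ennreal \<bar>k x\<bar> \<partial>M)"
  using integral_norm_bound_ennreal[of M k] by (cases "integrable M k") (auto simp: not_integrable_integral_eq)

text \<open>Integration by parts is applied to \<open>g\<close> clamped to \<open>[-n, n]\<close>,
  with a bound independent of \<open>n\<close>. As \<open>g\<close> is bounded, dominated
  convergence with a multiple of the absolute value of the centered \<open>h\<close> recovers the
  covariance.\<close>

lemma cov_le:
  assumes g: "locally_abs_continuous g" "Linf_norm \<mu> g < \<infinity>" and h: "integrable \<mu> h"
    and c: "c > 0" and density: "AE x in lborel. c * \<phi> x \<le> f x"
  shows "ennreal \<bar>cov \<mu> g h\<bar> \<le> ennreal (1 / c) * L1_norm \<mu> (deriv g)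
      * Linf_norm \<mu> (T_op \<mu> (ereal (median \<mu>)) (centered \<mu> h))"
proof -
  let ?h = "centered \<mu> h"
  let ?T = "T_op \<mu> (ereal (median \<mu>)) ?h"
  define R where "R = ennreal (1 / c) * L1_norm \<mu> (deriv g) * Linf_norm \<mu> ?T"
  obtain p where p: "p \<in> borel_measurable borel" "AE x in lborel. (g has_real_derivative p x) (at x)"
    "\<And>u v. set_integrable lborel {u..v} p" "\<And>u v. u \<le> v \<Longrightarrow> g v - g u = (LBINT t:{u..v}. p t)"
    using locally_abs_continuous_derivative[OF g(1)] by blast
  note [measurable] = p(1)
  have cont: "continuous_on UNIV g"
    by (rule locally_abs_continuous_imp_continuous[OF g(1)])
  then have [measurable]: "g \<in> borel_measurable borel"
    by (rule borel_measurable_continuous_onI)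
  have [measurable]: "?h \<in> borel_measurable borel"
    using centered_integrable[OF h] by auto
  obtain B where B: "\<And>x. \<bar>g x\<bar> \<le> B"
    using Linf_norm_bounded[OF cont g(2)] by blast
  have T_le: "AE t in lborel. ennreal \<bar>?T t\<bar> \<le> Linf_norm \<mu> ?T"
    using esssup_AE[of "\<lambda>x. ennreal \<bar>?T x\<bar>" \<mu>] unfolding Linf_norm_def AE_mu .
  have pointwise: "AE t in lborel. ennreal \<bar>indicat_real {- real n..real n} t *\<^sub>R (p t * tail_integral h t)\<bar>
      \<le> ennreal (1 / c) * (ennreal (f t) * ennreal \<bar>p t\<bar>) * Linf_norm \<mu> ?T" for n
    using T_le density
  proof eventually_elim
    case (elim t)
    have "ennreal \<bar>indicat_real {- real n..real n} t *\<^sub>R (p t * tail_integral h t)\<bar>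
        \<le> ennreal (\<bar>p t\<bar> * \<bar>tail_integral h t\<bar>)"
      by (intro ennreal_leI) (auto simp: abs_mult split: split_indicator)
    also have "\<dots> = ennreal (\<bar>p t\<bar> * \<phi> t) * ennreal \<bar>?T t\<bar>"
      using \<phi>_pos[of t] by (simp add: abs_tail_integral[OF h] ennreal_mult' mult.assoc)
    also have "\<dots> \<le> ennreal (\<bar>p t\<bar> * (1 / c * f t)) * Linf_norm \<mu> ?T"
      using elim c by (intro mult_mono ennreal_leI mult_left_mono) (auto simp: field_simps)
    also have "\<dots> = ennreal (1 / c) * (ennreal (f t) * ennreal \<bar>p t\<bar>) * Linf_norm \<mu> ?T"
      using c f_pos[of t] by (simp add: ennreal_mult'[symmetric] ennreal_mult''[symmetric] less_imp_le mult.commute mult.left_commute)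
    finally show ?case .
  qed
  have bound: "ennreal \<bar>\<integral>x. g (max (- real n) (min (real n) x)) * ?h x \<partial>\<mu>\<bar> \<le> R" for n
  proof -
    have "ennreal \<bar>\<integral>x. g (max (- real n) (min (real n) x)) * ?h x \<partial>\<mu>\<bar>
        = ennreal \<bar>LBINT t:{- real n..real n}. p t * tail_integral h t\<bar>"
      by (subst integral_clamped_eq[OF p(3,4) h]) auto
    also have "\<dots> \<le> (\<integral>\<^sup>+t. ennreal \<bar>indicat_real {- real n..real n} t *\<^sub>R (p t * tail_integral h t)\<bar> \<partial>lborel)"
      unfolding set_lebesgue_integral_def by (rule integral_abs_le_nn)
    also have "\<dots> \<le> (\<integral>\<^sup>+t. ennreal (1 / c) * (ennreal (f t) * ennreal \<bar>p t\<bar>) * Linf_norm \<mu> ?T \<partial>lborel)"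
      by (rule nn_integral_mono_AE[OF pointwise])
    \<comment> \<open>Constants leave the integral in \<open>ennreal\<close> even when infinite, and
      \<open>0 * \<infinity> = 0\<close> has the same meaning on both sides; no case split on the
      norms arises.\<close>
    also have "\<dots> = R"
      unfolding R_def L1_norm_deriv[OF p(1,2)]
      by (subst nn_integral_multc; (subst nn_integral_cmult)?) auto
    finally show ?thesis .
  qed
  have "(\<lambda>n. \<integral>x. g (max (- real n) (min (real n) x)) * ?h x \<partial>\<mu>) \<longlonglongrightarrow> cov \<mu> g h"
    unfolding cov_def
  proof (rule integral_dominated_convergence)
    show "integrable \<mu> (\<lambda>x. B * \<bar>?h x\<bar>)"
      using centered_integrable[OF h] by simp
    show "AE x in \<mu>. (\<lambda>n. g (max (- real n) (min (real n) x)) * ?h x) \<longlonglongrightarrow> g x * ?h x"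
    proof (rule AE_I2)
      fix x
      obtain N where N: "\<bar>x\<bar> < real N"
        using reals_Archimedean2 by blast
      have "\<forall>\<^sub>F n in sequentially. g (max (- real n) (min (real n) x)) * ?h x = g x * ?h x"
        using eventually_ge_at_top[of N]
      proof eventually_elim
        case (elim n)
        have "real N \<le> real n" using elim by simp
        with N have "max (- real n) (min (real n) x) = x" by auto
        then show ?case by simp
      qed
      then show "(\<lambda>n. g (max (- real n) (min (real n) x)) * ?h x) \<longlonglongrightarrow> g x * ?h x"
        by (rule tendsto_eventually)
    qed
    show "AE x in \<mu>. norm (g (max (- real n) (min (real n) x)) * ?h x) \<le> B * \<bar>?h x\<bar>" for n
      by (rule AE_I2) (auto simp: abs_mult intro!: mult_right_mono B)
  qed measurable
  then have "(\<lambda>n. ennreal \<bar>\<integral>x. g (max (- real n) (min (real n) x)) * ?h x \<partial>\<mu>\<bar>) \<longlonglongrightarrow> ennreal \<bar>cov \<mu> g h\<bar>"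
    by (intro tendsto_ennrealI tendsto_rabs)
  then show ?thesis
    unfolding R_def[symmetric] by (rule LIMSEQ_le_const2) (use bound in blast)
qed

lemma cov_ineq_inverse_Is:
  assumes "Is \<mu> > 0"
  shows "L1_Linf_cov_ineq \<mu> (1 / Is \<mu>)"
proof -
  obtain c where c: "Is \<mu> = ennreal c" "c > 0"
    using assms Is_finite by (cases "Is \<mu>") auto
  have "AE x in lborel. c * \<phi> x \<le> f x"
    using Is_le_density
  proof eventually_elim
    case (elim x)
    then have "ennreal (c * \<phi> x) \<le> ennreal (f x)"
      using c \<phi>_pos[of x] by (simp add: ennreal_mult')
    then show ?case
      using f_pos[of x] by simp
  qed
  moreover have "1 / Is \<mu> = ennreal (1 / c)"
    using c by (simp add: divide_ennreal_def inverse_ennreal inverse_eq_divide)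
  ultimately show ?thesis
    unfolding L1_Linf_cov_ineq_def using cov_le[OF _ _ _ c(2)] c(2) by auto
qed

section \<open>The sup norm of the operator\<close>

lemma integrable_indicator_mu: "A \<in> sets borel \<Longrightarrow> integrable \<mu> (indicat_real A)"
  by (intro integrable_real_indicator) (auto simp: emeasure_eq_measure)

text \<open>The value at \<open>x\<close> is the mean of \<open>h\<close> over the half-line of
  measure \<open>\<phi> x\<close>, and a mean does not exceed the bound on the function.\<close>

lemma T_op_bounded:
  assumes h: "integrable \<mu> h" and B: "\<And>x. \<bar>h x\<bar> \<le> B"
  shows "\<bar>T_op \<mu> (ereal (median \<mu>)) h x\<bar> \<le> B"
proof -
  have set_bound: "\<bar>LINT y:A|\<mu>. h y\<bar> \<le> B * measure \<mu> A" if [measurable]: "A \<in> sets borel" for A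
  proof -
    have "\<bar>LINT y:A|\<mu>. h y\<bar> \<le> (\<integral>y. \<bar>indicat_real A y *\<^sub>R h y\<bar> \<partial>\<mu>)"
      unfolding set_lebesgue_integral_def using integral_norm_bound[of \<mu> "\<lambda>y. indicat_real A y *\<^sub>R h y"] by simp
    also have "\<dots> \<le> (\<integral>y. B * indicat_real A y \<partial>\<mu>)"
    proof (rule integral_mono)
      show "integrable \<mu> (\<lambda>y. \<bar>indicat_real A y *\<^sub>R h y\<bar>)"
        using h by (intro integrable_abs integrable_mult_indicator) auto
      show "\<bar>indicat_real A y *\<^sub>R h y\<bar> \<le> B * indicat_real A y" for y
        using B[of y] by (auto split: split_indicator)
      show "integrable \<mu> (\<lambda>y. B * indicat_real A y)"
        by (intro integrable_mult_right integrable_indicator_mu) simp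
    qed
    finally show ?thesis by simp
  qed
  have "B * measure \<mu> {..x} = B * \<phi> x" if "x \<le> median \<mu>"
    using that by (simp add: \<phi>_eq cdf_def)
  moreover have "B * measure \<mu> {x<..} = B * \<phi> x" if "\<not> x \<le> median \<mu>"
    using that by (simp add: \<phi>_eq measure_greaterThan)
  ultimately show ?thesis
    unfolding T_op_eq using \<phi>_pos[of x] set_bound[of "{..x}"] set_bound[of "{x<..}"]
    by (auto simp: abs_divide pos_divide_le_eq)
qed

end

section \<open>Lipschitz cutoff functions\<close>

text \<open>The choice \<open>\<epsilon> / (L + 1)\<close> for \<open>\<delta>\<close> keeps the
  divisor positive when \<open>L = 0\<close> and makes the final inequality strict.\<close>

lemma lipschitz_locally_abs_continuous:
  assumes L: "\<And>x y. \<bar>g x - g y\<bar> \<le> L * \<bar>x - y\<bar>"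
  shows "locally_abs_continuous g"
  unfolding locally_abs_continuous_def abs_continuous_on_interval_def
proof (intro allI impI)
  fix u v \<epsilon> :: real assume "\<epsilon> > 0"
  have "0 \<le> L"
    using L[of 0 1] by simp
  have "(\<Sum>(s, t)\<in>D. \<bar>g t - g s\<bar>) < \<epsilon>"
    if D: "D \<subseteq> {(s, t). u \<le> s \<and> s \<le> t \<and> t \<le> v}" "(\<Sum>(s, t)\<in>D. t - s) < \<epsilon> / (L + 1)" for D
  proof -
    have "(\<Sum>(s, t)\<in>D. \<bar>g t - g s\<bar>) \<le> (\<Sum>(s, t)\<in>D. L * (t - s))"
    proof (rule sum_mono)
      fix z assume "z \<in> D"
      then show "(case z of (s, t) \<Rightarrow> \<bar>g t - g s\<bar>) \<le> (case z of (s, t) \<Rightarrow> L * (t - s))"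
        using D(1) L[of "snd z" "fst z"] by (auto simp: case_prod_beta)
    qed
    also have "\<dots> = L * (\<Sum>(s, t)\<in>D. t - s)"
      by (simp add: sum_distrib_left case_prod_beta)
    also have "\<dots> \<le> L * (\<epsilon> / (L + 1))"
      using D(2) \<open>0 \<le> L\<close> by (intro mult_left_mono) auto
    also have "\<dots> < \<epsilon>"
      using \<open>0 \<le> L\<close> \<open>\<epsilon> > 0\<close> by (simp add: field_simps)
    finally show ?thesis .
  qed
  then show "\<exists>\<delta>>0. \<forall>D. finite D \<and> D \<subseteq> {(s, t). u \<le> s \<and> s \<le> t \<and> t \<le> v}
        \<and> pairwise (\<lambda>p q. {fst p<..<snd p} \<inter> {fst q<..<snd q} = {}) D
        \<and> (\<Sum>(s, t)\<in>D. t - s) < \<delta>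
        \<longrightarrow> (\<Sum>(s, t)\<in>D. \<bar>g t - g s\<bar>) < \<epsilon>"
    using \<open>0 \<le> L\<close> \<open>\<epsilon> > 0\<close> by (intro exI[of _ "\<epsilon> / (L + 1)"]) auto
qed

lemma lipschitz_derivative_bound:
  assumes L: "\<And>x y. \<bar>g x - g y\<bar> \<le> L * \<bar>x - y\<bar>" and "(g has_real_derivative D) (at x)"
  shows "\<bar>D\<bar> \<le> L"
proof -
  have "((\<lambda>h. \<bar>(g (x + h) - g x) / h\<bar>) \<longlongrightarrow> \<bar>D\<bar>) (at 0)"
    using assms(2) unfolding DERIV_def by (rule tendsto_rabs)
  moreover have "\<forall>\<^sub>F h in at 0. \<bar>(g (x + h) - g x) / h\<bar> \<le> L"
  proof (rule eventually_at_filter[THEN iffD2], rule always_eventually, intro allI impI)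
    fix h :: real assume "h \<noteq> 0"
    then show "\<bar>(g (x + h) - g x) / h\<bar> \<le> L"
      using L[of "x + h" x] by (simp add: abs_divide divide_le_eq)
  qed
  ultimately show ?thesis
    by (intro tendsto_upperbound[of _ _ "at 0"]) auto
qed

text \<open>Equal to 1 on \<open>A\<close> and falling linearly with the distance, to 0 at distance
  \<open>s\<close>. Since \<open>infdist\<close> to the empty set is 0, the cutoff of the empty set
  is constantly 1; hence the condition \<open>A \<noteq> {}\<close> below.\<close>

definition cutoff :: "real set \<Rightarrow> real \<Rightarrow> real \<Rightarrow> real" where
  "cutoff A s x = max 0 (1 - infdist x A / s)"

lemma enlargement_iff_infdist:
  assumes "A \<noteq> {}"
  shows "x \<in> enlargement A s \<longleftrightarrow> infdist x A < s"
proof -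
  have "bdd_below (dist x ` A)"
    by (rule bdd_belowI2[of _ 0]) simp
  then have "infdist x A < s \<longleftrightarrow> (\<exists>a\<in>A. dist x a < s)"
    using assms by (simp add: infdist_notempty cINF_less_iff)
  then show ?thesis
    by (simp add: enlargement_def dist_real_def)
qed

lemma open_enlargement: "open (enlargement A s)"
proof -
  have "enlargement A s = (\<Union>a\<in>A. ball a s)"
    by (auto simp: enlargement_def dist_real_def abs_minus_commute)
  then show ?thesis by auto
qed

lemma cutoff_range: "s > 0 \<Longrightarrow> 0 \<le> cutoff A s x" "s > 0 \<Longrightarrow> cutoff A s x \<le> 1"
  by (auto simp: cutoff_def infdist_nonneg)

lemma cutoff_inside: "x \<in> A \<Longrightarrow> cutoff A s x = 1"
  by (simp add: cutoff_def)

lemma cutoff_outside: "s > 0 \<Longrightarrow> A \<noteq> {} \<Longrightarrow> x \<notin> enlargement A s \<Longrightarrow> cutoff A s x = 0"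
  by (simp add: cutoff_def enlargement_iff_infdist not_less)

lemma cutoff_lipschitz:
  assumes "s > 0"
  shows "\<bar>cutoff A s x - cutoff A s y\<bar> \<le> (1 / s) * \<bar>x - y\<bar>"
proof -
  have "\<bar>cutoff A s x - cutoff A s y\<bar> \<le> \<bar>infdist x A / s - infdist y A / s\<bar>"
    by (auto simp: cutoff_def max_def abs_if)
  also have "\<dots> = \<bar>infdist x A - infdist y A\<bar> / s"
    using assms by (simp add: abs_divide flip: diff_divide_distrib)
  also have "\<dots> \<le> dist x y / s"
    using assms infdist_triangle_abs[of x A y] by (intro divide_right_mono) auto
  finally show ?thesis
    by (simp add: dist_real_def)
qed

section \<open>Cutoffs as test functions and lower bounds for the boundary measure\<close>

context positive_density
begin

text \<open>Points of \<open>A\<close> are maxima of the cutoff and points outside the enlargement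
  are minima, so the derivative, where it exists, vanishes there, also at boundary points of these
  sets. On the remaining shell the Lipschitz constant \<open>1 / s\<close> bounds it.\<close>

lemma L1_norm_deriv_cutoff:
  assumes "s > 0" "A \<noteq> {}" and [measurable]: "A \<in> sets borel"
  shows "L1_norm \<mu> (deriv (cutoff A s)) \<le> ennreal ((measure \<mu> (enlargement A s) - measure \<mu> A) / s)"
proof -
  let ?g = "cutoff A s"
  have [measurable]: "enlargement A s \<in> sets borel"
    using open_enlargement by auto
  have sub: "A \<subseteq> enlargement A s"
    using \<open>s > 0\<close> by (force simp: enlargement_def)
  obtain p where p: "AE x in lborel. (?g has_real_derivative p x) (at x)"
    by (rule locally_abs_continuous_derivative[OF lipschitz_locally_abs_continuous[OF cutoff_lipschitz[OF \<open>s > 0\<close>]]])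
  have "AE x in \<mu>. ennreal \<bar>deriv ?g x\<bar> \<le> ennreal (1 / s) * indicator (enlargement A s - A) x"
    unfolding AE_mu using p
  proof eventually_elim
    case (elim x)
    have d: "deriv ?g x = p x"
      using elim by (rule DERIV_imp_deriv)
    consider "x \<in> A" | "x \<notin> enlargement A s" | "x \<in> enlargement A s - A"
      by blast
    then show ?case
    proof cases
      case 1
      have "p x = 0"
        by (rule DERIV_local_max[OF elim, of 1]) (use 1 \<open>s > 0\<close> cutoff_range cutoff_inside in auto)
      then show ?thesis
        by (simp add: d)
    next
      case 2
      have "p x = 0"
        by (rule DERIV_local_min[OF elim, of 1]) (use 2 \<open>s > 0\<close> \<open>A \<noteq> {}\<close> cutoff_range cutoff_outside in auto)
      then show ?thesis
        by (simp add: d)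
    next
      case 3
      then show ?thesis
        using lipschitz_derivative_bound[OF cutoff_lipschitz[OF \<open>s > 0\<close>] elim] by (simp add: d ennreal_leI)
    qed
  qed
  then have "L1_norm \<mu> (deriv ?g) \<le> (\<integral>\<^sup>+x. ennreal (1 / s) * indicator (enlargement A s - A) x \<partial>\<mu>)"
    unfolding L1_norm_def by (rule nn_integral_mono_AE)
  also have "\<dots> = ennreal (1 / s) * emeasure \<mu> (enlargement A s - A)"
    by (rule nn_integral_cmult_indicator) simp
  also have "\<dots> = ennreal ((measure \<mu> (enlargement A s) - measure \<mu> A) / s)"
    using \<open>s > 0\<close> sub by (simp add: emeasure_eq_measure finite_measure_Diff flip: ennreal_mult')
  finally show ?thesis .
qed

text \<open>The covariance inequality with \<open>g = h =\<close> \<^term>\<open>cutoff A s\<close>.\<close>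

lemma variance_cutoff_le:
  assumes ineq: "L1_Linf_cov_ineq \<mu> (ennreal \<rho>)"
    and "s > 0" "A \<noteq> {}" and [measurable]: "A \<in> sets borel"
  defines "\<alpha> \<equiv> measure \<mu> A" and "\<beta> \<equiv> measure \<mu> (enlargement A s)"
  shows "\<alpha> - \<beta>\<^sup>2 \<le> \<rho> * ((\<beta> - \<alpha>) / s) * max \<beta> (1 - \<alpha>)"
proof -
  let ?g = "cutoff A s"
  let ?h = "centered \<mu> ?g"
  have "\<rho> > 0"
    using ineq by (auto simp: L1_Linf_cov_ineq_def)
  have [measurable]: "enlargement A s \<in> sets borel"
    using open_enlargement by auto
  have sub: "A \<subseteq> enlargement A s"
    using \<open>s > 0\<close> by (force simp: enlargement_def)
  have "\<alpha> \<le> \<beta>"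
    unfolding \<alpha>_def \<beta>_def using sub by (intro finite_measure_mono) auto
  have lac: "locally_abs_continuous ?g"
    by (rule lipschitz_locally_abs_continuous[OF cutoff_lipschitz[OF \<open>s > 0\<close>]])
  then have [measurable]: "?g \<in> borel_measurable borel"
    by (intro borel_measurable_continuous_onI locally_abs_continuous_imp_continuous)
  have g_int: "integrable \<mu> ?g"
    using cutoff_range[OF \<open>s > 0\<close>] by (intro integrable_const_bound[where B=1]) auto
  have g2_int: "integrable \<mu> (\<lambda>x. (?g x)\<^sup>2)"
    using cutoff_range[OF \<open>s > 0\<close>] by (intro integrable_const_bound[where B=1]) (auto simp: power_le_one)
  define e where "e = (\<integral>x. ?g x \<partial>\<mu>)"
  \<comment> \<open>These bounds place the mean between \<open>\<alpha>\<close> and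
    \<open>\<beta>\<close> and the second moment above \<open>\<alpha>\<close>, so the variance is
    at least \<open>\<alpha> - \<beta>\<^sup>2\<close>.\<close>
  have "indicator A x \<le> ?g x" "?g x \<le> indicator (enlargement A s) x" "indicator A x \<le> (?g x)\<^sup>2" for x
    using cutoff_range[OF \<open>s > 0\<close>, of A x] cutoff_inside[of x A s] cutoff_outside[OF \<open>s > 0\<close> \<open>A \<noteq> {}\<close>, of x]
    by (auto split: split_indicator)
  then have "(\<integral>x. indicator A x \<partial>\<mu>) \<le> e" "e \<le> (\<integral>x. indicator (enlargement A s) x \<partial>\<mu>)"
    "(\<integral>x. indicator A x \<partial>\<mu>) \<le> (\<integral>x. (?g x)\<^sup>2 \<partial>\<mu>)"
    unfolding e_def using g_int g2_int by (intro integral_mono integrable_indicator_mu; simp)+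
  then have e: "\<alpha> \<le> e" "e \<le> \<beta>" "\<alpha> \<le> (\<integral>x. (?g x)\<^sup>2 \<partial>\<mu>)"
    by (simp_all add: \<alpha>_def \<beta>_def)
  have "\<alpha> \<ge> 0" by (simp add: \<alpha>_def)
  have "cov \<mu> ?g ?g = (\<integral>x. (?g x)\<^sup>2 - e * ?g x \<partial>\<mu>)"
    unfolding cov_def centered_def e_def by (simp add: algebra_simps power2_eq_square)
  also have "\<dots> = (\<integral>x. (?g x)\<^sup>2 \<partial>\<mu>) - e\<^sup>2"
    using g_int g2_int by (simp add: e_def power2_eq_square)
  finally have cov: "\<alpha> - \<beta>\<^sup>2 \<le> cov \<mu> ?g ?g"
    using e \<open>\<alpha> \<ge> 0\<close> power_mono[of e \<beta> 2] by linarith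
  \<comment> \<open>Values in \<open>[0, 1]\<close> and a mean \<open>e\<close> in
    \<open>[\<alpha>, \<beta>]\<close> put the centered cutoff between \<open>-\<beta>\<close> and
    \<open>1 - \<alpha>\<close>.\<close>
  have h_bound: "\<bar>?h x\<bar> \<le> max \<beta> (1 - \<alpha>)" for x
    using cutoff_range[OF \<open>s > 0\<close>, of A x] e by (auto simp: centered_def e_def)
  have "Linf_norm \<mu> (T_op \<mu> (ereal (median \<mu>)) ?h) \<le> ennreal (max \<beta> (1 - \<alpha>))"
    unfolding Linf_norm_def
  proof (rule esssup_I)
    have "?h \<in> borel_measurable borel"
      unfolding centered_def[abs_def] by measurable
    from T_op_measurable[OF this]
    show "(\<lambda>x. ennreal \<bar>T_op \<mu> (ereal (median \<mu>)) ?h x\<bar>) \<in> borel_measurable \<mu>"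
      by simp
    show "AE x in \<mu>. ennreal \<bar>T_op \<mu> (ereal (median \<mu>)) ?h x\<bar> \<le> ennreal (max \<beta> (1 - \<alpha>))"
      by (intro AE_I2 ennreal_leI T_op_bounded h_bound centered_integrable g_int)
  qed
  moreover have "Linf_norm \<mu> ?g < \<infinity>"
  proof -
    have "Linf_norm \<mu> ?g \<le> ennreal 1"
      unfolding Linf_norm_def using cutoff_range[OF \<open>s > 0\<close>, of A]
      by (intro esssup_I AE_I2) (auto intro!: ennreal_leI simp del: ennreal_1)
    then show ?thesis
      by (simp add: le_less_trans)
  qed
  then have "ennreal \<bar>cov \<mu> ?g ?g\<bar>
      \<le> ennreal \<rho> * L1_norm \<mu> (deriv ?g) * Linf_norm \<mu> (T_op \<mu> (ereal (median \<mu>)) ?h)"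
    using ineq lac g_int unfolding L1_Linf_cov_ineq_def by auto
  ultimately have "ennreal \<bar>cov \<mu> ?g ?g\<bar> \<le> ennreal \<rho> * ennreal ((\<beta> - \<alpha>) / s) * ennreal (max \<beta> (1 - \<alpha>))"
    using L1_norm_deriv_cutoff[OF \<open>s > 0\<close> \<open>A \<noteq> {}\<close>, folded \<alpha>_def \<beta>_def]
    by (elim order_trans) (intro mult_mono; simp add: \<alpha>_def \<beta>_def)
  also have "\<dots> = ennreal (\<rho> * ((\<beta> - \<alpha>) / s) * max \<beta> (1 - \<alpha>))"
    using \<open>\<rho> > 0\<close> \<open>\<alpha> \<le> \<beta>\<close> \<open>s > 0\<close> \<open>\<alpha> \<ge> 0\<close> by (simp add: ennreal_mult' flip: ennreal_mult'')
  finally have "\<bar>cov \<mu> ?g ?g\<bar> \<le> \<rho> * ((\<beta> - \<alpha>) / s) * max \<beta> (1 - \<alpha>)"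
    using \<open>\<rho> > 0\<close> \<open>\<alpha> \<le> \<beta>\<close> \<open>s > 0\<close> \<open>\<alpha> \<ge> 0\<close> by (subst (asm) ennreal_le_iff) (auto intro!: mult_nonneg_nonneg simp: le_max_iff_disj)
  then show ?thesis
    using cov by linarith
qed

lemma boundary_measure_ge:
  assumes ineq: "L1_Linf_cov_ineq \<mu> (ennreal \<rho>)" and A: "A \<in> sets borel"
  shows "ennreal (min (measure \<mu> A) (1 - measure \<mu> A) / \<rho>) \<le> boundary_measure \<mu> A"
proof (rule ccontr)
  define \<alpha> where "\<alpha> = measure \<mu> A"
  define \<beta> where "\<beta> s = measure \<mu> (enlargement A s)" for s
  have \<rho>: "\<rho> > 0"
    using ineq by (auto simp: L1_Linf_cov_ineq_def)
  have \<alpha>: "0 \<le> \<alpha>" "\<alpha> \<le> 1"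
    by (simp_all add: \<alpha>_def)
  assume "\<not> ?thesis"
  then have less: "boundary_measure \<mu> A < ennreal (min \<alpha> (1 - \<alpha>) / \<rho>)"
    by (simp add: \<alpha>_def not_le)
  \<comment> \<open>A value strictly above an \<open>ennreal\<close> cannot be 0, so
    \<open>A\<close> has positive measure and is nonempty, as the cutoff requires.\<close>
  then have pos: "0 < min \<alpha> (1 - \<alpha>)"
    using \<rho> by (metis divide_nonpos_pos ennreal_neg not_le not_less_zero)
  then have "A \<noteq> {}"
    by (auto simp: \<alpha>_def)
  \<comment> \<open>Strictness on the left provides scales with quotient below \<open>l\<close>;
    strictness on the right leaves a margin that survives the passage to small
    \<open>s\<close>.\<close>
  obtain l where l: "boundary_measure \<mu> A < ennreal l" "ennreal l < ennreal (min \<alpha> (1 - \<alpha>) / \<rho>)" "0 \<le> l"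
  proof -
    obtain z where z: "boundary_measure \<mu> A < z" "z < ennreal (min \<alpha> (1 - \<alpha>) / \<rho>)"
      using dense[OF less] by blast
    then obtain l where "z = ennreal l" "0 \<le> l"
      by (cases z) auto
    with z show thesis by (intro that[of l]) auto
  qed
  have l': "\<rho> * l < min \<alpha> (1 - \<alpha>)"
    using l(2,3) \<rho> by (simp add: ennreal_less_iff pos_less_divide_eq mult.commute)
  \<comment> \<open>The liminf controls the quotient only at some arbitrarily small scales. The
    other requirements hold for all small \<open>s\<close>, so a single scale can meet them
    all.\<close>
  have "\<not> (\<forall>\<^sub>F s in at_right 0. ennreal l \<le> ennreal ((\<beta> s - \<alpha>) / s))"
    using l(1) Liminf_bounded[of "ennreal l" "\<lambda>s. ennreal ((\<beta> s - \<alpha>) / s)" "at_right 0"]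
    unfolding boundary_measure_def \<alpha>_def \<beta>_def by (auto simp: not_le)
  then have freq: "\<exists>\<^sub>F s in at_right 0. (\<beta> s - \<alpha>) / s < l"
    unfolding frequently_def by (rule contrapos_nn) (auto elim!: eventually_mono intro!: ennreal_leI)
  \<comment> \<open>The contradiction margin, with \<open>\<alpha> + l * s\<close> standing in for
    the measure of the enlargement. Its limit is positive because
    \<open>\<alpha> - \<alpha>\<^sup>2\<close> is the product of the minimum and the maximum of
    \<open>\<alpha>\<close> and \<open>1 - \<alpha>\<close>, and \<open>\<rho> * l\<close> is below
    the minimum.\<close>
  let ?\<Delta> = "\<lambda>s. \<alpha> - (\<alpha> + l * s)\<^sup>2 - \<rho> * l * max (\<alpha> + l * s) (1 - \<alpha>)"
  have "(?\<Delta> \<longlongrightarrow> \<alpha> - (\<alpha> + l * 0)\<^sup>2 - \<rho> * l * max (\<alpha> + l * 0) (1 - \<alpha>)) (at_right 0)"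
    by (intro tendsto_intros)
  moreover have "0 < \<alpha> - (\<alpha> + l * 0)\<^sup>2 - \<rho> * l * max (\<alpha> + l * 0) (1 - \<alpha>)"
  proof -
    have "\<rho> * l * max \<alpha> (1 - \<alpha>) < min \<alpha> (1 - \<alpha>) * max \<alpha> (1 - \<alpha>)"
      using l' pos by (intro mult_strict_right_mono) auto
    also have "\<dots> = \<alpha> - \<alpha>\<^sup>2"
      by (auto simp: min_def max_def power2_eq_square algebra_simps)
    finally show ?thesis by simp
  qed
  ultimately have "\<forall>\<^sub>F s in at_right 0. 0 < ?\<Delta> s"
    by (rule order_tendstoD)
  then have "\<forall>\<^sub>F s in at_right 0. 0 < ?\<Delta> s \<and> 0 < s"
    using eventually_at_right_less[of "0::real"] by eventually_elim auto
  with freq have "\<exists>\<^sub>F s in at_right 0. (\<beta> s - \<alpha>) / s < l \<and> 0 < ?\<Delta> s \<and> 0 < s"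
    by (rule frequently_eventually_frequently)
  then obtain s where s: "(\<beta> s - \<alpha>) / s < l" "0 < ?\<Delta> s" "0 < s"
    by (auto dest: frequently_ex)
  \<comment> \<open>For a set that is not closed, the measure of the enlargement need not tend to
    that of \<open>A\<close>. At the chosen scale the small quotient itself forces the two to be
    within \<open>l * s\<close>.\<close>
  have \<beta>_less: "\<beta> s < \<alpha> + l * s"
    using s by (simp add: pos_divide_less_eq)
  have "\<alpha> \<le> \<beta> s"
    unfolding \<alpha>_def \<beta>_def using s(3) open_enlargement[of A s]
    by (intro finite_measure_mono) (force simp: enlargement_def)+
  have "\<alpha> - (\<beta> s)\<^sup>2 \<le> \<rho> * ((\<beta> s - \<alpha>) / s) * max (\<beta> s) (1 - \<alpha>)"
    unfolding \<alpha>_def \<beta>_def by (rule variance_cutoff_le[OF ineq s(3) \<open>A \<noteq> {}\<close> A])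
  also have "\<dots> \<le> \<rho> * l * max (\<alpha> + l * s) (1 - \<alpha>)"
    using s \<beta>_less \<rho> \<open>\<alpha> \<le> \<beta> s\<close> \<alpha> l(3) by (intro mult_mono) auto
  also have "\<dots> < \<alpha> - (\<alpha> + l * s)\<^sup>2"
    using s(2) by simp
  also have "\<dots> \<le> \<alpha> - (\<beta> s)\<^sup>2"
    using \<beta>_less \<open>\<alpha> \<le> \<beta> s\<close> \<alpha> power_mono[of "\<beta> s" "\<alpha> + l * s" 2] by simp
  finally show False by simp
qed

lemma inverse_constant_le_Is:
  assumes "L1_Linf_cov_ineq \<mu> (ennreal \<rho>)"
  shows "ennreal (1 / \<rho>) \<le> Is \<mu>"
proof -
  have "\<rho> > 0"
    using assms by (auto simp: L1_Linf_cov_ineq_def)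
  then have "ennreal (1 / \<rho>) * ennreal (min (measure \<mu> A) (1 - measure \<mu> A)) \<le> boundary_measure \<mu> A"
    if "A \<in> sets borel" for A
    using boundary_measure_ge[OF assms that] by (simp flip: ennreal_mult')
  then show ?thesis
    unfolding Is_def by (intro Sup_upper) auto
qed

lemma Is_inverse_le:
  assumes "L1_Linf_cov_ineq \<mu> r"
  shows "Is \<mu> > 0 \<and> 1 / Is \<mu> \<le> r"
proof -
  obtain \<rho> where \<rho>: "r = ennreal \<rho>" "\<rho> > 0"
    using assms unfolding L1_Linf_cov_ineq_def by (cases r) auto
  obtain c where c: "Is \<mu> = ennreal c" "0 \<le> c"
    using Is_finite by (cases "Is \<mu>") auto
  have "1 / \<rho> \<le> c"
    using inverse_constant_le_Is assms \<rho> c by simp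
  moreover have "0 < 1 / \<rho>"
    using \<rho> by simp
  ultimately have "c > 0" by linarith
  moreover have "1 / Is \<mu> = ennreal (1 / c)"
    using c \<open>c > 0\<close> by (simp add: divide_ennreal_def inverse_ennreal inverse_eq_divide)
  moreover have "1 / c \<le> \<rho>"
    using \<open>1 / \<rho> \<le> c\<close> \<open>c > 0\<close> \<rho>(2) by (simp add: field_simps)
  ultimately show ?thesis
    using c \<rho> by (simp add: ennreal_leI)
qed

end

theorem proposition2p1:
  fixes \<mu> :: "real measure" and f :: "real \<Rightarrow> real"
  assumes "prob_space \<mu>"
    and "f \<in> borel_measurable borel"
    and "\<And>x. f x > 0"
    and "\<mu> = density lborel (\<lambda>x. ennreal (f x))"
  shows "((\<exists>r. L1_Linf_cov_ineq \<mu> r) \<longrightarrow> Is \<mu> > 0 \<and> 1 / Is \<mu> \<le> Cov_1_inf \<mu>)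
       \<and> (Is \<mu> > 0 \<longrightarrow> L1_Linf_cov_ineq \<mu> (1 / Is \<mu>))
       \<and> ((\<exists>r. L1_Linf_cov_ineq \<mu> r) \<longrightarrow> 1 / Is \<mu> = Cov_1_inf \<mu>)"
proof -
  interpret positive_density \<mu> f
    using assms by (rule positive_density.intro)
  \<comment> \<open>The infimum of the empty set is \<open>\<infinity>\<close>, so this bound does
    not presuppose that some covariance inequality holds.\<close>
  have lower: "1 / Is \<mu> \<le> Cov_1_inf \<mu>"
    unfolding Cov_1_inf_def by (rule Inf_greatest) (use Is_inverse_le in auto)
  \<comment> \<open>The constant \<open>1 / Is \<mu>\<close> itself belongs to the set of admissible
    constants, so the infimum is attained.\<close>
  moreover have "Cov_1_inf \<mu> \<le> 1 / Is \<mu>" if "Is \<mu> > 0"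
    unfolding Cov_1_inf_def using cov_ineq_inverse_Is[OF that] by (intro Inf_lower) simp
  ultimately show ?thesis
    using cov_ineq_inverse_Is Is_inverse_le by (auto intro: antisym)
qed

end
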